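(* There are polynomial-time $n/2$-Hamming-approximation algorithms for the optimization versions of unweighted Vertex Cover, Independent Set, and Clique. Concretely, there are deterministic polynomial-time algorithms that, given a graph $G$ on $n$ vertices (and nothing else), output a vertex subset $S$ whose Hamming distance is at most $n/2$ from some minimum-size vertex cover of $G$; and likewise from some maximum-size independent set of $G$, and from some maximum-size clique of $G$.
   Context: Vertex subsets of an $n$-vertex graph are identified with their characteristic $n$-bit strings. The Hamming distance between two subsets is the size of their symmetric difference. *)

theory Defs
  imports "HOL-Computational_Algebra.Polynomial"
begin

section \<open>Graphs, covers, independent sets, cliques\<close>

text \<open>A finite simple undirected graph on n vertices has vertex set {..<n} and a set of
  two-element edges. A vertex subset is a subset of {..<n}, i.e. an n-bit string.\<close>

definition simple_graph :: "nat \<Rightarrow> nat set set \<Rightarrow> bool" where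
  "simple_graph n E \<longleftrightarrow> (\<forall>e\<in>E. \<exists>u v. u < n \<and> v < n \<and> u \<noteq> v \<and> e = {u, v})"

definition vertex_cover :: "nat \<Rightarrow> nat set set \<Rightarrow> nat set \<Rightarrow> bool" where
  "vertex_cover n E C \<longleftrightarrow> C \<subseteq> {..<n} \<and> (\<forall>e\<in>E. e \<inter> C \<noteq> {})"

definition independent_set :: "nat \<Rightarrow> nat set set \<Rightarrow> nat set \<Rightarrow> bool" where
  "independent_set n E I \<longleftrightarrow> I \<subseteq> {..<n} \<and> (\<forall>u\<in>I. \<forall>v\<in>I. {u, v} \<notin> E)"

definition clique :: "nat \<Rightarrow> nat set set \<Rightarrow> nat set \<Rightarrow> bool" where
  "clique n E K \<longleftrightarrow> K \<subseteq> {..<n} \<and> (\<forall>u\<in>K. \<forall>v\<in>K. u \<noteq> v \<longrightarrow> {u, v} \<in> E)"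

definition min_vertex_cover :: "nat \<Rightarrow> nat set set \<Rightarrow> nat set \<Rightarrow> bool" where
  "min_vertex_cover n E = is_arg_min card (vertex_cover n E)"

definition max_independent_set :: "nat \<Rightarrow> nat set set \<Rightarrow> nat set \<Rightarrow> bool" where
  "max_independent_set n E = is_arg_max card (independent_set n E)"

definition max_clique :: "nat \<Rightarrow> nat set set \<Rightarrow> nat set \<Rightarrow> bool" where
  "max_clique n E = is_arg_max card (clique n E)"


section \<open>Hamming approximation\<close>

definition hamming_distance :: "nat set \<Rightarrow> nat set \<Rightarrow> nat" where
  "hamming_distance S T = card (sym_diff S T)"

text \<open>Here \<open>opt n E T\<close> says that T is an optimal solution for the graph \<open>(n, E)\<close>.\<close>

definition hamming_approximation ::
    "(nat \<Rightarrow> real) \<Rightarrow> (nat \<Rightarrow> nat set set \<Rightarrow> nat set \<Rightarrow> bool) \<Rightarrow>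
     (nat \<Rightarrow> nat set set \<Rightarrow> nat set) \<Rightarrow> bool" where
  "hamming_approximation d opt A \<longleftrightarrow>
     (\<forall>n E. simple_graph n E \<longrightarrow>
        A n E \<subseteq> {..<n} \<and>
        (\<exists>T. opt n E T \<and> real (hamming_distance (A n E) T) \<le> d n))"


section \<open>Deterministic polynomial time\<close>

text \<open>The machine model is a random access machine with structured control. Registers and
  memory cells hold natural numbers; \<open>LOAD\<close> and \<open>STORE\<close> address the memory
  indirectly. The only arithmetic is addition and truncated subtraction, each at unit cost:
  a step makes the largest stored number at most twice as large (up to constants of the
  program), so after t steps every number has O(t + log n) bits, and polynomial time on this
  machine coincides with polynomial time on Turing machines. (Unit-cost multiplication would
  break this.)\<close>

datatype instr =
    SET nat nat      \<comment> \<open>\<open>SET r k\<close>: register r gets k\<close>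
  | ADD nat nat nat    \<comment> \<open>\<open>ADD r a b\<close>: register r gets the sum of registers a and b\<close>
  | SUB nat nat nat
  | LOAD nat nat       \<comment> \<open>\<open>LOAD r a\<close>: r gets the memory cell whose address is in a\<close>
  | STORE nat nat      \<comment> \<open>\<open>STORE a r\<close>: the memory cell whose address is in a gets r\<close>

datatype prog =
    INSTR instr
  | SEQ prog prog
  | IFNZ nat prog prog
  | WHILENZ nat prog

type_synonym state = "(nat \<Rightarrow> nat) \<times> (nat \<Rightarrow> nat)"  \<comment> \<open>registers, memory\<close>

fun step :: "instr \<Rightarrow> state \<Rightarrow> state" where
  "step (SET r k) (R, M) = (R(r := k), M)"
| "step (ADD r a b) (R, M) = (R(r := R a + R b), M)"
| "step (SUB r a b) (R, M) = (R(r := R a - R b), M)"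
| "step (LOAD r a) (R, M) = (R(r := M (R a)), M)"
| "step (STORE a r) (R, M) = (R, M(R a := R r))"

text \<open>\<open>exec P s t s'\<close>: started in state s, program P terminates in state s' after
  exactly t steps. Every instruction and every test of a condition is one step.\<close>

inductive exec :: "prog \<Rightarrow> state \<Rightarrow> nat \<Rightarrow> state \<Rightarrow> bool" where
  Instr: "exec (INSTR i) s 1 (step i s)"
| Seq: "exec P s t s' \<Longrightarrow> exec Q s' u s'' \<Longrightarrow> exec (SEQ P Q) s (t + u) s''"
| IfTrue: "fst s r \<noteq> 0 \<Longrightarrow> exec P s t s' \<Longrightarrow> exec (IFNZ r P Q) s (1 + t) s'"
| IfFalse: "fst s r = 0 \<Longrightarrow> exec Q s t s' \<Longrightarrow> exec (IFNZ r P Q) s (1 + t) s'"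
| WhileFalse: "fst s r = 0 \<Longrightarrow> exec (WHILENZ r P) s 1 s"
| WhileTrue: "fst s r \<noteq> 0 \<Longrightarrow> exec P s t s' \<Longrightarrow> exec (WHILENZ r P) s' u s'' \<Longrightarrow>
    exec (WHILENZ r P) s (1 + t + u) s''"

inductive_cases InstrE: "exec (INSTR i) s t s'"
inductive_cases SeqE: "exec (SEQ P Q) s t s'"
inductive_cases IfE: "exec (IFNZ r P Q) s t s'"
inductive_cases WhileE: "exec (WHILENZ r P) s t s'"

lemma exec_deterministic:
  "exec P s t s' \<Longrightarrow> exec P s u s'' \<Longrightarrow> t = u \<and> s' = s''"
proof (induction arbitrary: u s'' rule: exec.induct)
  case (Instr i s)
  then show ?case by (auto elim: InstrE)
next
  case (Seq P s t s' Q v s3)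
  from Seq.prems show ?case by (rule SeqE) (metis Seq.IH)
next
  case (IfTrue s r P t s' Q)
  from IfTrue.prems show ?case by (rule IfE) (use IfTrue.hyps(1) in \<open>auto dest!: IfTrue.IH\<close>)
next
  case (IfFalse s r Q t s' P)
  from IfFalse.prems show ?case by (rule IfE) (use IfFalse.hyps(1) in \<open>auto dest!: IfFalse.IH\<close>)
next
  case (WhileFalse s r P)
  from WhileFalse.prems show ?case by (rule WhileE) (use WhileFalse.hyps in simp_all)
next
  case (WhileTrue s r P t s' v s3)
  from WhileTrue.prems show ?case
  proof (rule WhileE)
    fix t' s1 u'
    assume "exec P s t' s1" and while: "exec (WHILENZ r P) s1 u' s''" and u: "u = Suc (t' + u')"
    then have "t = t'" "s' = s1" using WhileTrue.IH(1) by blast+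
    with while u show ?thesis using WhileTrue.IH(2) by simp
  qed (use WhileTrue.hyps in simp)
qed

text \<open>Input: register 0 holds n, and memory cells 0, ..., n * n - 1 hold the adjacency
  matrix row by row; everything else is 0.\<close>

definition input_state :: "nat \<Rightarrow> nat set set \<Rightarrow> state" where
  "input_state n E =
     ((\<lambda>r. if r = 0 then n else 0),
      (\<lambda>a. if a < n * n \<and> {a div n, a mod n} \<in> E then 1 else 0))"

text \<open>Output: memory cells 0, ..., n - 1 hold the n-bit characteristic string of S.\<close>

definition output_is :: "nat \<Rightarrow> nat set \<Rightarrow> state \<Rightarrow> bool" where
  "output_is n S s \<longleftrightarrow> S \<subseteq> {..<n} \<and> (\<forall>v<n. snd s v = (if v \<in> S then 1 else 0))"

text \<open>The input has length of order n * n, so a time bound polynomial in n is the same as one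
  polynomial in the length of the input.\<close>

definition polytime_computable :: "(nat \<Rightarrow> nat set set \<Rightarrow> nat set) \<Rightarrow> bool" where
  "polytime_computable A \<longleftrightarrow>
     (\<exists>P (p :: nat poly). \<forall>n E. simple_graph n E \<longrightarrow>
        (\<exists>t s. exec P (input_state n E) t s \<and> t \<le> poly p n \<and> output_is n (A n E) s))"

end

(* Let I be an independent set that maximises |I| - |N(I)|. Replacing N(I) by I in any maximum
   independent set gives a maximum independent set T containing I, and maximality of the deficiency
   forces |T - I| <= |N(T) - N(I)|. These two sets are disjoint, so T - I has at most n/2 elements
   and I itself is the approximation (a combinatorial form of the Nemhauser-Trotter theorem).

   Such an I is found by an auction on the bipartite double cover: an unserved vertex bids for its
   cheapest neighbour, raising its price by one and evicting the previous owner, until all its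
   neighbours cost n + 1. As there are only n prices, some h in 1, ..., n + 1 is not a price; the
   vertices of price at most h all of whose neighbours cost more than h form I. Vertex covers are
   complements of independent sets, cliques are independent sets of the complement graph. *)
theory Submission
  imports Defs
begin

section \<open>Independent sets of maximum deficiency\<close>

text \<open>No optimum is ever computed, so the bound has to come from a computable set that lies
  inside some unknown optimum. Deficiency is accessible because it is a matching quantity: for every
  \<open>Z\<close>, those of its bidders that own an item own one in N(Z), so |Z| - |N(Z)| is at
  most the number of unserved bidders. The set cut out by the prices attains this number, and that
  certifies its maximality. An auction takes the place of augmenting paths: its state is two arrays
  changed one cell at a time, correctness is a local invariant, and the sum of the prices measures
  progress. In return an owner is only within one unit of its cheapest item. The missing price
  \<open>h\<close> absorbs this error: an item dearer than \<open>h\<close> costs at least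
  \<open>h + 1\<close>, so all items its owner sees cost at least \<open>h\<close>, and none costs
  exactly \<open>h\<close>. The limit n + 1 fits both needs: bidders that gave up must also see only
  items dearer than \<open>h\<close>, so \<open>h\<close> may not exceed the limit, and n + 1
  candidates guarantee a free one.\<close>

definition neighbours :: "nat \<Rightarrow> nat set set \<Rightarrow> nat set \<Rightarrow> nat set" where
  "neighbours n E X = {w. w < n \<and> (\<exists>u\<in>X. {u, w} \<in> E)}"

text \<open>Doubling the distance keeps the bound n/2 in the natural numbers, for odd
  \<open>n\<close> as well.\<close>

definition near_max_independent :: "nat \<Rightarrow> nat set set \<Rightarrow> nat set \<Rightarrow> bool" where
  "near_max_independent n E I \<longleftrightarrow>
     I \<subseteq> {..<n} \<and> (\<exists>T. max_independent_set n E T \<and> 2 * hamming_distance I T \<le> n)"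

lemma finite_neighbours [simp]: "finite (neighbours n E X)"
  unfolding neighbours_def by simp

lemma independent_set_neighbours:
  "independent_set n E I \<longleftrightarrow> I \<subseteq> {..<n} \<and> I \<inter> neighbours n E I = {}"
  unfolding independent_set_def neighbours_def by blast

lemma independent_set_finite: "independent_set n E I \<Longrightarrow> finite I"
  unfolding independent_set_def using finite_subset by blast

lemma max_independent_set_exists: "\<exists>T. max_independent_set n E T"
proof -
  have "independent_set n E {}" by (simp add: independent_set_def)
  moreover have "\<forall>I. independent_set n E I \<longrightarrow> card I < Suc n"
    by (metis card_lessThan card_mono finite_lessThan independent_set_def le_imp_less_Suc)
  ultimately have "\<exists>T. independent_set n E T \<and> (\<forall>I. independent_set n E I \<longrightarrow> card I \<le> card T)"
    by (rule ex_has_greatest_nat)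
  then show ?thesis
    unfolding max_independent_set_def is_arg_max_linorder by blast
qed

lemma near_max_independent_if_max_deficiency:
  assumes I: "independent_set n E I"
    and max: "\<And>X. independent_set n E X \<Longrightarrow>
      card X + card (neighbours n E I) \<le> card I + card (neighbours n E X)"
  shows "near_max_independent n E I"
proof -
  let ?N = "neighbours n E"
  obtain J where J: "max_independent_set n E J" using max_independent_set_exists by blast
  then have indJ: "independent_set n E J"
    and maxJ: "\<And>X. independent_set n E X \<Longrightarrow> card X \<le> card J"
    unfolding max_independent_set_def is_arg_max_linorder by auto
  have fin: "finite I" "finite J" using I indJ independent_set_finite by auto
  \<comment> \<open>Exchanging the neighbours of I for I does not shrink a maximum independent set.\<close>
  define T where "T = (J - ?N I) \<union> I"
  have indT: "independent_set n E T"
    using I indJ unfolding independent_set_def T_def neighbours_def subset_iff lessThan_iff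
    by (auto, metis insert_commute)
  \<comment> \<open>Maximality is tested on the part of \<open>I\<close> that \<open>J\<close>
    already has. Its neighbours avoid \<open>J\<close>, so they fit into \<open>?N I\<close> beside
    the removed vertices \<open>J \<inter> ?N I\<close>; hence the removal costs no more than
    \<open>I - J\<close> brings in.\<close>
  have "card (I \<inter> J) + card (?N I) \<le> card I + card (?N (I \<inter> J))"
    using I by (intro max) (auto simp: independent_set_def)
  moreover have "card (?N (I \<inter> J)) + card (J \<inter> ?N I) \<le> card (?N I)"
  proof -
    have "?N (I \<inter> J) \<inter> (J \<inter> ?N I) = {}" 
      using indJ unfolding independent_set_def neighbours_def by auto
    then have "card (?N (I \<inter> J)) + card (J \<inter> ?N I) = card (?N (I \<inter> J) \<union> (J \<inter> ?N I))"
      by (simp add: card_Un_disjoint)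
    also have "\<dots> \<le> card (?N I)"
      by (intro card_mono) (auto simp: neighbours_def)
    finally show ?thesis .
  qed
  ultimately have le: "card (I \<inter> J) + card (J \<inter> ?N I) \<le> card I" by linarith
  have "card T = card J - card (J \<inter> ?N I) + (card I - card (I \<inter> J))"
  proof -
    have T: "T = (J - ?N I) \<union> (I - J)"
      using I unfolding T_def independent_set_neighbours by blast
    have "card T = card (J - ?N I) + card (I - J)"
      unfolding T using fin by (intro card_Un_disjoint) auto
    then show ?thesis using fin by (simp add: card_Diff_subset_Int)
  qed
  moreover have "card (J \<inter> ?N I) \<le> card J" using fin by (intro card_mono) auto
  ultimately have "card J \<le> card T" using le by linarith
  then have maxT: "max_independent_set n E T"
    unfolding max_independent_set_def is_arg_max_linorder using indT maxJ order_trans by blast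
  have finT: "finite T" using indT independent_set_finite by blast
  have "I \<subseteq> T" unfolding T_def by blast
  let ?L = "T - I"
  have "card T + card (?N I) \<le> card I + card (?N T)" using max indT by blast
  moreover have "card (?N T - ?N I) = card (?N T) - card (?N I)"
    using \<open>I \<subseteq> T\<close> by (intro card_Diff_subset) (auto simp: neighbours_def)
  moreover have "card ?L = card T - card I" using \<open>I \<subseteq> T\<close> fin by (simp add: card_Diff_subset)
  ultimately have "card ?L \<le> card (?N T - ?N I)" by linarith
  moreover have "card ?L + card (?N T - ?N I) \<le> n"
  proof -
    have "card ?L + card (?N T - ?N I) = card (?L \<union> (?N T - ?N I))"
      using finT indT by (intro card_Un_disjoint[symmetric]) (auto simp: independent_set_neighbours)
    also have "\<dots> \<le> card {..<n}"
      using indT by (intro card_mono) (auto simp: independent_set_def neighbours_def)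
    finally show ?thesis by simp
  qed
  moreover have "hamming_distance I T = card ?L"
    using \<open>I \<subseteq> T\<close> by (simp add: hamming_distance_def Diff_eq_empty_iff[THEN iffD2])
  ultimately show ?thesis
    unfolding near_max_independent_def using maxT I by (auto simp: independent_set_def)
qed

section \<open>Auctions on the bipartite double cover\<close>

text \<open>The bipartite double cover has a bidder and an item for every vertex. \<open>C\<close> is the
  set of bidders not yet treated, \<open>ow v = Suc u\<close> means that item v belongs to bidder u
  (0: to nobody), and a bidder without an item has given up because every adjacent item costs K.\<close>

definition auction ::
    "nat \<Rightarrow> (nat \<Rightarrow> nat \<Rightarrow> bool) \<Rightarrow> nat \<Rightarrow> (nat \<Rightarrow> nat) \<Rightarrow> (nat \<Rightarrow> nat) \<Rightarrow> nat set \<Rightarrow> bool" where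
  "auction n adj K p ow C \<longleftrightarrow>
     C \<subseteq> {..<n} \<and>
     (\<forall>v<n. p v \<le> K \<and> ow v \<le> n \<and> (p v > 0 \<longrightarrow> ow v > 0)) \<and>
     (\<forall>v<n. \<forall>u. ow v = Suc u \<longrightarrow>
        u \<notin> C \<and> adj u v \<and> (\<forall>w<n. adj u w \<longrightarrow> p v \<le> Suc (p w)) \<and>
        (\<forall>w<n. ow w = Suc u \<longrightarrow> w = v)) \<and>
     (\<forall>u<n. u \<notin> C \<longrightarrow> (\<exists>v<n. ow v = Suc u) \<or> (\<forall>w<n. adj u w \<longrightarrow> K \<le> p w))"

lemma auction_init: "auction n adj K (\<lambda>_. 0) (\<lambda>_. 0) {..<n}"
  unfolding auction_def by auto

text \<open>Prices will be read from memory, where the price array runs into the owner array beyond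
  index \<open>n\<close>; after a write they agree with the abstract update only below
  \<open>n\<close>.\<close>

lemma auction_cong:
  assumes "\<And>v. v < n \<Longrightarrow> p v = p' v" "\<And>v. v < n \<Longrightarrow> ow v = ow' v"
  shows "auction n adj K p ow C \<longleftrightarrow> auction n adj K p' ow' C"
  unfolding auction_def
  by (intro conj_cong all_cong1 ex_cong1 imp_cong disj_cong refl) (simp_all add: assms)

lemma auction_give_up:
  assumes "auction n adj K p ow C" "\<And>w. w < n \<Longrightarrow> adj u w \<Longrightarrow> K \<le> p w"
  shows "auction n adj K p ow (C - {u})"
  using assms unfolding auction_def by blast

text \<open>Choosing a cheapest item keeps the new owner within one unit of its best offer after the
  raise; the other owners stay within it because prices never fall. An item once sold only changes
  hands, so a positive price still implies an owner, and an evicted bidder becomes untreated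
  again.\<close>

lemma auction_bid:
  assumes a: "auction n adj K p ow C" and "u \<in> C" "v < n" "adj u v" "p v < K"
    and min: "\<And>w. w < n \<Longrightarrow> adj u w \<Longrightarrow> p v \<le> p w"
  shows "auction n adj K (p(v := Suc (p v))) (ow(v := Suc u)) (C - {u} \<union> {w. ow v = Suc w})"
    (is "auction n adj K ?p ?o ?C")
proof -
  have C: "C \<subseteq> {..<n}"
    and bd: "\<And>v. v < n \<Longrightarrow> p v \<le> K \<and> ow v \<le> n \<and> (p v > 0 \<longrightarrow> ow v > 0)"
    and ow: "\<And>v u. v < n \<Longrightarrow> ow v = Suc u \<Longrightarrow>
        u \<notin> C \<and> adj u v \<and> (\<forall>w<n. adj u w \<longrightarrow> p v \<le> Suc (p w)) \<and>
        (\<forall>w<n. ow w = Suc u \<longrightarrow> w = v)"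
    and settled: "\<And>u. u < n \<Longrightarrow> u \<notin> C \<Longrightarrow> (\<exists>v<n. ow v = Suc u) \<or> (\<forall>w<n. adj u w \<longrightarrow> K \<le> p w)"
    using a unfolding auction_def by blast+
  have "u < n" using C \<open>u \<in> C\<close> by auto
  have 1: "?C \<subseteq> {..<n}" using C bd[OF \<open>v < n\<close>] by auto
  have 2: "\<forall>v<n. ?p v \<le> K \<and> ?o v \<le> n \<and> (?p v > 0 \<longrightarrow> ?o v > 0)"
    using bd \<open>p v < K\<close> \<open>u < n\<close> by auto
  have 3: "u' \<notin> ?C \<and> adj u' x \<and> (\<forall>w<n. adj u' w \<longrightarrow> ?p x \<le> Suc (?p w)) \<and>
        (\<forall>w<n. ?o w = Suc u' \<longrightarrow> w = x)" if x: "x < n" "?o x = Suc u'" for x u'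
  proof (cases "x = v")
    case True
    then have "u' = u" using x by simp
    \<comment> \<open>An untreated bidder owned nothing before, so \<open>v\<close> is now its only
      item.\<close>
    moreover have "ow w \<noteq> Suc u" if "w < n" for w using ow[OF that] \<open>u \<in> C\<close> by blast
    ultimately show ?thesis using True min \<open>adj u v\<close> \<open>v < n\<close> by (auto simp: le_SucI)
  next
    case False
    then have o: "ow x = Suc u'" using x by simp
    have "u' \<noteq> u" using ow[OF x(1) o] \<open>u \<in> C\<close> by blast
    then show ?thesis using False ow[OF x(1) o] \<open>v < n\<close> by (auto simp: le_SucI)
  qed
  have 4: "(\<exists>v<n. ?o v = Suc x) \<or> (\<forall>w<n. adj x w \<longrightarrow> K \<le> ?p w)" if "x < n" "x \<notin> ?C" for x
  proof (cases "x = u")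
    case True then show ?thesis using \<open>v < n\<close> by auto
  next
    case False
    then have "x \<notin> C" "ow v \<noteq> Suc x" using that by auto
    then show ?thesis using settled[OF \<open>x < n\<close>] by (fastforce simp: le_SucI)
  qed
  show ?thesis unfolding auction_def using 1 2 3 4 by blast
qed

text \<open>As no price equals h, the owner of an item dearer than h sees only items dearer than h.
  The bidders all of whose items are dearer than h therefore violate Hall's condition
  maximally.\<close>

lemma auction_finished:
  assumes g: "simple_graph n E" and a: "auction n (\<lambda>u v. {u, v} \<in> E) K p ow {}"
    and "h \<le> K" and gap: "\<And>v. v < n \<Longrightarrow> p v \<noteq> h"
  shows "near_max_independent n E {u. u < n \<and> p u \<le> h \<and> (\<forall>w<n. {u, w} \<in> E \<longrightarrow> h < p w)}"
    (is "near_max_independent n E ?I")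
proof -
  have bd: "\<And>v. v < n \<Longrightarrow> p v \<le> K \<and> ow v \<le> n \<and> (p v > 0 \<longrightarrow> ow v > 0)"
    and ow: "\<And>v u. v < n \<Longrightarrow> ow v = Suc u \<Longrightarrow> {u, v} \<in> E \<and> 
        (\<forall>w<n. {u, w} \<in> E \<longrightarrow> p v \<le> Suc (p w)) \<and> (\<forall>w<n. ow w = Suc u \<longrightarrow> w = v)"
    and settled: "\<And>u. u < n \<Longrightarrow> (\<exists>v<n. ow v = Suc u) \<or> (\<forall>w<n. {u, w} \<in> E \<longrightarrow> K \<le> p w)"
    using a unfolding auction_def by blast+
  let ?N = "neighbours n E"
  define Y where "Y = {v. v < n \<and> h < p v}"
  define X where "X = {u. u < n \<and> (\<forall>w<n. {u, w} \<in> E \<longrightarrow> h < p w)}"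
  define U where "U = {u. u < n \<and> (\<forall>v<n. ow v \<noteq> Suc u)}"
  have fin [simp]: "finite X" "finite Y" "finite U" unfolding X_def Y_def U_def by auto
  have I: "?I = X - Y" unfolding X_def Y_def by auto
  \<comment> \<open>Owners of items dearer than \<open>h\<close> and bidders without an item form
    two disjoint parts of \<open>X\<close>, the first as large as \<open>Y\<close>. This makes the
    deficiency of \<open>X\<close> at least \<open>card U\<close>.\<close>
  have YU: "card Y + card U \<le> card X"
  proof -
    let ?f = "\<lambda>v. ow v - 1"
    \<comment> \<open>A price above \<open>h\<close> is positive, so the item has an owner and
      \<open>ow v - 1\<close> is not a truncated 0.\<close>
    have o: "ow v = Suc (?f v)" if "v \<in> Y" for v using bd[of v] that unfolding Y_def by auto
    have "inj_on ?f Y"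
    proof (rule inj_onI)
      fix v w assume "v \<in> Y" "w \<in> Y" "?f v = ?f w"
      then show "v = w" using o[of v] o[of w] ow[of w "?f w"] unfolding Y_def by auto
    qed
    then have "card Y = card (?f ` Y)" by (simp add: card_image)
    moreover have "?f ` Y \<inter> U = {}" using o unfolding Y_def U_def by blast
    then have "card (?f ` Y) + card U = card (?f ` Y \<union> U)" by (simp add: card_Un_disjoint)
    moreover have "?f ` Y \<union> U \<subseteq> X"
    proof
      fix u assume "u \<in> ?f ` Y \<union> U"
      then consider v where "v < n" "h < p v" "ow v = Suc u" | "u \<in> U"
        using o Y_def by blast
      then show "u \<in> X"
      proof cases
        case 1
        then have "u < n" using bd[of v] by auto
        \<comment> \<open>From \<open>h < p v\<close> and \<open>p v \<le> Suc (p w)\<close> only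
          \<open>h \<le> p w\<close> follows; the gap makes it strict.\<close>
        moreover have "h < p w" if "w < n" "{u, w} \<in> E" for w
          using ow[OF 1(1,3)] that 1(2) gap[of w] by force
        ultimately show ?thesis unfolding X_def by blast
      next
        case 2
        then have "u < n" "\<And>w. w < n \<Longrightarrow> {u, w} \<in> E \<Longrightarrow> K \<le> p w" using settled[of u] unfolding U_def by auto
        then show ?thesis unfolding X_def using \<open>h \<le> K\<close> gap by (fastforce simp: le_less)
      qed
    qed
    then have "card (?f ` Y \<union> U) \<le> card X" by (intro card_mono) auto
    ultimately show ?thesis by simp
  qed
  \<comment> \<open>A neighbour of \<open>u \<in> X - Y\<close> is dear because \<open>u\<close> is
    in \<open>X\<close>, and it is outside \<open>X\<close> because \<open>u\<close> itself is
    cheap.\<close>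
  have "?N (X - Y) \<subseteq> Y - X"
  proof
    fix w assume "w \<in> ?N (X - Y)"
    then obtain u where u: "w < n" "u \<in> X - Y" "{u, w} \<in> E" "{w, u} \<in> E"
      unfolding neighbours_def by (auto simp: insert_commute)
    then show "w \<in> Y - X" unfolding X_def Y_def by force
  qed
  then have NI: "card (?N (X - Y)) \<le> card (Y - X)" by (intro card_mono) auto
  have "independent_set n E (X - Y)"
    unfolding independent_set_def X_def Y_def by auto
  then have "near_max_independent n E (X - Y)"
  proof (rule near_max_independent_if_max_deficiency)
    fix Z assume Z: "independent_set n E Z"
    then have "finite Z" using independent_set_finite by blast
    \<comment> \<open>The other half of the duality: served bidders of \<open>Z\<close> own distinct
      items, all adjacent to \<open>Z\<close>, so the deficiency of \<open>Z\<close> is at most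
      \<open>card U\<close>.\<close>
    have "Z - U \<subseteq> (\<lambda>v. ow v - 1) ` ?N Z"
    proof
      fix u assume "u \<in> Z - U"
      then obtain v where "v < n" "ow v = Suc u"
        using Z unfolding U_def independent_set_def by blast
      then have "v \<in> ?N Z"
        using ow[of v u] \<open>u \<in> Z - U\<close> unfolding neighbours_def by blast
      then show "u \<in> (\<lambda>v. ow v - 1) ` ?N Z" using \<open>ow v = Suc u\<close> by force
    qed
    then have "card (Z - U) \<le> card (?N Z)" by (rule surj_card_le[rotated]) simp
    moreover have "card Z \<le> card (Z - U) + card U"
    proof -
      have "card Z \<le> card ((Z - U) \<union> U)" using \<open>finite Z\<close> by (intro card_mono) auto
      then show ?thesis using card_Un_le order_trans by blast
    qed
    \<comment> \<open>The common part cancels: passing from \<open>X\<close> and \<open>Y\<close> to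
      \<open>X - Y\<close> and \<open>Y - X\<close> makes the Hall violator independent without
      lowering its deficiency.\<close>
    moreover have "card X = card (X - Y) + card (X \<inter> Y)" "card Y = card (Y - X) + card (X \<inter> Y)"
      using card_Int_Diff[OF fin(1), of Y] card_Int_Diff[OF fin(2), of X] by (simp_all add: Int_commute)
    ultimately show "card Z + card (?N (X - Y)) \<le> card (X - Y) + card (?N Z)"
      using NI YU by linarith
  qed
  then show ?thesis unfolding I .
qed

section \<open>Vertex covers and cliques\<close>

definition complement_graph :: "nat \<Rightarrow> nat set set \<Rightarrow> nat set set" where
  "complement_graph n E = {{u, v} |u v. u < n \<and> v < n \<and> u \<noteq> v \<and> {u, v} \<notin> E}"

lemma simple_complement_graph: "simple_graph n (complement_graph n E)"
  unfolding simple_graph_def complement_graph_def by blast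

lemma complement_graph_iff:
  "{u, v} \<in> complement_graph n E \<longleftrightarrow> u < n \<and> v < n \<and> u \<noteq> v \<and> {u, v} \<notin> E"
proof
  assume "{u, v} \<in> complement_graph n E"
  then obtain a b where "{u, v} = {a, b}" "a < n" "b < n" "a \<noteq> b" "{a, b} \<notin> E"
    unfolding complement_graph_def by blast
  then show "u < n \<and> v < n \<and> u \<noteq> v \<and> {u, v} \<notin> E"
    by (metis doubleton_eq_iff)
qed (auto simp: complement_graph_def)

lemma independent_set_complement_graph: "independent_set n (complement_graph n E) = clique n E"
  by (intro ext) (auto simp: independent_set_def clique_def complement_graph_iff)

lemma vertex_cover_iff_independent_set:
  assumes "simple_graph n E"
  shows "vertex_cover n E C \<longleftrightarrow> C \<subseteq> {..<n} \<and> independent_set n E ({..<n} - C)"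
proof -
  have "(\<forall>e\<in>E. e \<inter> C \<noteq> {}) \<longleftrightarrow> (\<forall>u<n. \<forall>v<n. {u, v} \<in> E \<longrightarrow> u \<in> C \<or> v \<in> C)"
    using assms unfolding simple_graph_def by fastforce
  then show ?thesis unfolding vertex_cover_def independent_set_def by auto
qed

lemma min_vertex_cover_complement:
  assumes g: "simple_graph n E" and T: "max_independent_set n E T"
  shows "min_vertex_cover n E ({..<n} - T)"
proof -
  have T': "independent_set n E T" "T \<subseteq> {..<n}"
    and max: "\<And>X. independent_set n E X \<Longrightarrow> card X \<le> card T"
    using T unfolding max_independent_set_def is_arg_max_linorder independent_set_def by auto
  have "card ({..<n} - T) \<le> card C" if "vertex_cover n E C" for C
  proof -
    have C: "C \<subseteq> {..<n}" "independent_set n E ({..<n} - C)"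
      using that vertex_cover_iff_independent_set[OF g] by auto
    have "card ({..<n} - C) = n - card C" "card ({..<n} - T) = n - card T"
      using C T' by (auto simp: card_Diff_subset finite_subset)
    then show ?thesis using max[OF C(2)] by linarith
  qed
  moreover have "vertex_cover n E ({..<n} - T)"
    using T' by (simp add: vertex_cover_iff_independent_set[OF g] double_diff)
  ultimately show ?thesis unfolding min_vertex_cover_def is_arg_min_linorder by blast
qed

text \<open>Complementing both sets preserves their symmetric difference, so a Hamming bound carries
  over between independent sets and covers, as a ratio of sizes would not.\<close>

lemma hamming_distance_complement:
  assumes "S \<subseteq> {..<n}" "T \<subseteq> {..<n}"
  shows "hamming_distance ({..<n} - S) ({..<n} - T) = hamming_distance S T"
  unfolding hamming_distance_def using assms by (intro arg_cong[where f = card]) auto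

section \<open>Total correctness with time bounds\<close>

text \<open>A total-correctness triple: the existential run asserts termination. Time is bounded
  rather than exact so that branches and iterations of different lengths share one bound.\<close>

definition runs ::
    "prog \<Rightarrow> (nat \<Rightarrow> nat) \<Rightarrow> (nat \<Rightarrow> nat) \<Rightarrow> nat \<Rightarrow>
     ((nat \<Rightarrow> nat) \<Rightarrow> (nat \<Rightarrow> nat) \<Rightarrow> bool) \<Rightarrow> bool" where
  "runs P R M b Q \<longleftrightarrow> (\<exists>t R' M'. exec P (R, M) t (R', M') \<and> t \<le> b \<and> Q R' M')"

lemma runs_mono:
  assumes "runs P R M b Q" "b \<le> c" "\<And>R' M'. Q R' M' \<Longrightarrow> Q' R' M'"
  shows "runs P R M c Q'"
  using assms unfolding runs_def by (meson order_trans)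

lemma runs_seq:
  assumes "runs P R M b Q'" "\<And>R' M'. Q' R' M' \<Longrightarrow> runs P' R' M' c Q" "b + c \<le> d"
  shows "runs (SEQ P P') R M d Q"
proof -
  obtain t R' M' where 1: "exec P (R, M) t (R', M')" "t \<le> b" "Q' R' M'"
    using assms(1) unfolding runs_def by blast
  obtain t' R'' M'' where 2: "exec P' (R', M') t' (R'', M'')" "t' \<le> c" "Q R'' M''"
    using assms(2)[OF 1(3)] unfolding runs_def by blast
  have "t + t' \<le> d" using 1 2 assms(3) by linarith
  then show ?thesis unfolding runs_def using exec.Seq[OF 1(1) 2(1)] 2(3) by blast
qed

lemma runs_instr [simp]:
  "runs (INSTR i) R M b Q \<longleftrightarrow> 1 \<le> b \<and> (case step i (R, M) of (R', M') \<Rightarrow> Q R' M')"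
proof -
  obtain R' M' where s: "step i (R, M) = (R', M')" by fastforce
  have "exec (INSTR i) (R, M) t (R2, M2) \<longleftrightarrow> t = 1 \<and> R2 = R' \<and> M2 = M'" for t R2 M2
    using exec.Instr[of i "(R, M)"] s by (auto elim: InstrE)
  then show ?thesis unfolding runs_def s by auto
qed

text \<open>Together with the simp rules for tests and for reassociation this turns simplification
  into symbolic execution that pays from the budget \<open>b\<close>; only loops and subprograms
  need \<open>runs_seq\<close>.\<close>

lemma runs_seq_instr [simp]:
  "runs (SEQ (INSTR i) P) R M b Q \<longleftrightarrow>
     1 \<le> b \<and> (case step i (R, M) of (R', M') \<Rightarrow> runs P R' M' (b - 1) Q)"
proof -
  obtain R' M' where s: "step i (R, M) = (R', M')" by fastforce
  show ?thesis
  proof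
    assume "runs (SEQ (INSTR i) P) R M b Q"
    then obtain t R2 M2 where e: "exec (SEQ (INSTR i) P) (R, M) t (R2, M2)" "t \<le> b" "Q R2 M2"
      unfolding runs_def by blast
    from e(1) obtain t' where "t = 1 + t'" "exec P (R', M') t' (R2, M2)"
      by (rule SeqE) (auto elim!: InstrE simp: s)
    then show "1 \<le> b \<and> (case step i (R, M) of (R', M') \<Rightarrow> runs P R' M' (b - 1) Q)"
      unfolding s runs_def using e(2,3)
      by simp (rule exI[of _ t'], rule exI[of _ R2], rule exI[of _ M2], simp)
  next
    assume a: "1 \<le> b \<and> (case step i (R, M) of (R', M') \<Rightarrow> runs P R' M' (b - 1) Q)"
    show "runs (SEQ (INSTR i) P) R M b Q"
      by (rule runs_seq[where b = 1 and c = "b - 1" and Q' = "\<lambda>x y. x = R' \<and> y = M'"])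
        (use a s in auto)
  qed
qed

lemma runs_ifnz [simp]:
  "runs (IFNZ r P P') R M b Q \<longleftrightarrow> 1 \<le> b \<and> (if R r \<noteq> 0 then runs P R M (b - 1) Q else runs P' R M (b - 1) Q)"
proof -
  have "exec (IFNZ r P P') (R, M) t s \<longleftrightarrow>
      (\<exists>t'. t = 1 + t' \<and> (if R r \<noteq> 0 then exec P (R, M) t' s else exec P' (R, M) t' s))" for t s
    using exec.IfTrue[of "(R, M)" r] exec.IfFalse[of "(R, M)" r]
    by (cases "R r = 0"; cases s) (auto elim: IfE)
  then show ?thesis unfolding runs_def by (cases "R r = 0"; cases b) (auto; blast)+
qed

lemma runs_seq_assoc [simp]: "runs (SEQ (SEQ P P') P'') R M b Q \<longleftrightarrow> runs (SEQ P (SEQ P' P'')) R M b Q"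
proof -
  have "exec (SEQ (SEQ P P') P'') s t s' \<longleftrightarrow> exec (SEQ P (SEQ P' P'')) s t s'" for s t s'
  proof
    assume "exec (SEQ (SEQ P P') P'') s t s'"
    then show "exec (SEQ P (SEQ P' P'')) s t s'"
      by (elim SeqE, hypsubst) (subst add.assoc, (rule exec.Seq, assumption)+)
  next
    assume "exec (SEQ P (SEQ P' P'')) s t s'"
    then show "exec (SEQ (SEQ P P') P'') s t s'"
      by (elim SeqE, hypsubst) (subst add.assoc[symmetric], rule exec.Seq, rule exec.Seq)
  qed
  then show ?thesis unfolding runs_def by simp
qed

text \<open>Copying the continuation into both branches brings the test to the front; the number of
  steps is the same on both sides.\<close>

lemma runs_seq_ifnz [simp]:
  "runs (SEQ (IFNZ r P P') P'') R M b Q \<longleftrightarrow> runs (IFNZ r (SEQ P P'') (SEQ P' P'')) R M b Q"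
proof -
  have "exec (SEQ (IFNZ r P P') P'') s t s' \<longleftrightarrow> exec (IFNZ r (SEQ P P'') (SEQ P' P'')) s t s'" for s t s'
  proof
    assume "exec (SEQ (IFNZ r P P') P'') s t s'"
    then show "exec (IFNZ r (SEQ P P'') (SEQ P' P'')) s t s'"
      by (elim SeqE IfE) (auto simp: exec.Seq exec.IfTrue[simplified] exec.IfFalse[simplified])
  next
    assume "exec (IFNZ r (SEQ P P'') (SEQ P' P'')) s t s'"
    then show "exec (SEQ (IFNZ r P P') P'') s t s'"
      using exec.Seq[OF exec.IfTrue[of s r P _ _ P']] exec.Seq[OF exec.IfFalse[of s r P' _ _ P]]
      by (elim SeqE IfE) (auto simp: add.assoc)
  qed
  then show ?thesis unfolding runs_def by simp
qed

text \<open>Each round costs one test and at most \<open>b\<close> steps and lowers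
  \<open>f\<close>, which gives \<open>f R M * Suc b\<close>; the final 1 is the test that
  fails.\<close>

lemma runs_while:
  fixes f :: "(nat \<Rightarrow> nat) \<Rightarrow> (nat \<Rightarrow> nat) \<Rightarrow> nat"
  assumes inv: "I R M"
    and body: "\<And>R M. I R M \<Longrightarrow> R r \<noteq> 0 \<Longrightarrow> runs P R M b (\<lambda>R' M'. I R' M' \<and> f R' M' < f R M)"
    and exit: "\<And>R M. I R M \<Longrightarrow> R r = 0 \<Longrightarrow> Q R M"
    and c: "f R M * Suc b + 1 \<le> c"
  shows "runs (WHILENZ r P) R M c Q"
  using inv c
proof (induction "f R M" arbitrary: R M c rule: less_induct)
  case less
  show ?case
  proof (cases "R r = 0")
    case True
    have "exec (WHILENZ r P) (R, M) 1 (R, M)" using True by (intro exec.WhileFalse) simp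
    moreover have "1 \<le> c" using less.prems by simp
    ultimately show ?thesis unfolding runs_def using exit[OF less.prems(1) True] by blast
  next
    case False
    obtain t R' M' where 1: "exec P (R, M) t (R', M')" "t \<le> b" "I R' M'" "f R' M' < f R M"
      using body[OF less.prems(1) False] unfolding runs_def by blast
    have "runs (WHILENZ r P) R' M' (f R' M' * Suc b + 1) Q" using less.hyps[OF 1(4,3)] by simp
    then obtain t' R'' M'' where 2: "exec (WHILENZ r P) (R', M') t' (R'', M'')"
      "t' \<le> f R' M' * Suc b + 1" "Q R'' M''" unfolding runs_def by blast
    have "exec (WHILENZ r P) (R, M) (1 + t + t') (R'', M'')"
      using False 1(1) 2(1) by (intro exec.WhileTrue) auto
    moreover have "1 + t + t' \<le> c"
    proof -
      have "Suc (f R' M') * Suc b \<le> f R M * Suc b" using 1(4) by (intro mult_right_mono) auto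
      then show ?thesis using 1(2) 2(2) less.prems(2) by simp
    qed
    ultimately show ?thesis unfolding runs_def using 2(3) by blast
  qed
qed

section \<open>The auction on the random access machine\<close>

text \<open>Registers 0 to 5 hold the constants n, n + 1, 1, 0, n * n, n * n + n. Since register 3
  always holds 0, \<open>SET 3 0\<close> serves as a no-op and \<open>ADD r a 3\<close> as a move. Loop
  counters run downwards and stand for the vertex one below, so that cells \<open>n * n + i\<close> and
  \<open>n * n + n + i\<close> hold price and owner of vertex \<open>i - 1\<close>, and its row in the
  matrix is addressed by \<open>i * n + j - (n + 1)\<close>.\<close>

definition mul_prog :: "nat \<Rightarrow> prog" where
  "mul_prog r = SEQ (INSTR (SET 8 0)) (SEQ (INSTR (ADD 9 r 3))
     (WHILENZ 9 (SEQ (INSTR (ADD 8 8 0)) (INSTR (SUB 9 9 2)))))"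

text \<open>Without unit-cost multiplication, row offsets come from repeated addition of
  \<open>n\<close>: three steps per round, two to initialise, one failing test. The multiplier is a
  vertex plus one, or \<open>n\<close>, so this stays linear in \<open>n\<close>.\<close>

lemma runs_mul:
  assumes "R 2 = 1" "R 3 = 0" "r < 8"
  shows "runs (mul_prog r) R M (R r * 3 + 3) (\<lambda>R' M'. R' = R(8 := R r * R 0, 9 := 0) \<and> M' = M)"
  unfolding mul_prog_def using assms
  apply simp
  apply (rule runs_while[where f = "\<lambda>R' M'. R' 9" and b = 2 and
      I = "\<lambda>R' M'. R' 9 \<le> R r \<and> R' = R(8 := (R r - R' 9) * R 0, 9 := R' 9) \<and> M' = M"])
  subgoal by auto
  subgoal premises p for R' M'
  proof -
    obtain k where k: "R' 9 = Suc k" using p by (cases "R' 9") auto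
    define m where "m = R r - Suc k"
    have m: "R r = m + Suc k" using k p(4) m_def by auto
    have R': "R' = R(8 := m * R 0, 9 := Suc k)" using p k m by auto
    have "M' = M" using p(4) by simp
    then show ?thesis unfolding R' using p(1-3) m by (simp add: fun_eq_iff)
  qed
  subgoal by (auto simp: fun_eq_iff)
  subgoal by simp
  done

definition const_regs :: "nat \<Rightarrow> (nat \<Rightarrow> nat) \<Rightarrow> bool" where
  "const_regs n R \<longleftrightarrow> R 0 = n \<and> R 1 = Suc n \<and> R 2 = 1 \<and> R 3 = 0 \<and> R 4 = n * n \<and> R 5 = n * n + n"

definition price :: "nat \<Rightarrow> (nat \<Rightarrow> nat) \<Rightarrow> nat \<Rightarrow> nat" where
  "price n M v = M (n * n + Suc v)"

definition owner :: "nat \<Rightarrow> (nat \<Rightarrow> nat) \<Rightarrow> nat \<Rightarrow> nat" where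
  "owner n M v = M (n * n + n + Suc v)"

definition adjacency :: "nat \<Rightarrow> (nat \<Rightarrow> nat \<Rightarrow> bool) \<Rightarrow> (nat \<Rightarrow> nat) \<Rightarrow> bool" where
  "adjacency n adj M \<longleftrightarrow> (\<forall>u<n. \<forall>v<n. adj u v \<longleftrightarrow> M (u * n + v) \<noteq> 0)"

lemma index_less: "u < n \<Longrightarrow> v < n \<Longrightarrow> u * n + v < n * (n::nat)"
proof -
  assume "u < n" "v < n"
  then have "u * n + v < Suc u * n" by simp
  also have "\<dots> \<le> n * n" using \<open>u < n\<close> by (intro mult_right_mono) auto
  finally show ?thesis .
qed

section \<open>Cheapest adjacent item and a single bid\<close>

definition scan_min :: prog where
  "scan_min = WHILENZ 9
     (SEQ (INSTR (ADD 10 8 9)) (SEQ (INSTR (SUB 10 10 1)) (SEQ (INSTR (LOAD 11 10))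
     (SEQ (IFNZ 11
        (SEQ (INSTR (ADD 10 4 9)) (SEQ (INSTR (LOAD 11 10)) (SEQ (INSTR (SUB 14 12 11))
          (IFNZ 14 (SEQ (INSTR (ADD 12 11 3)) (INSTR (ADD 13 9 3))) (INSTR (SET 3 0))))))
        (INSTR (SET 3 0)))
     (INSTR (SUB 9 9 2))))))"

text \<open>Registers 12 and 13 carry the best price so far and its vertex plus one. The start value
  n + 1 doubles as the price limit: only a strictly cheaper item replaces it, so register 13 remains
  0 exactly when the bidder must give up.\<close>

lemma runs_scan_min:
  assumes c: "const_regs n R" and a: "adjacency n adj M" and u: "u < n"
    and r: "R 8 = Suc u * n" "R 9 = n" "R 12 = Suc n" "R 13 = 0"
  shows "runs scan_min R M (n * 12 + 1) (\<lambda>R' M'. M' = M \<and> (\<forall>k. k \<notin> {9..14} \<longrightarrow> R' k = R k) \<and>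
     (\<forall>v<n. adj u v \<longrightarrow> R' 12 \<le> price n M v) \<and>
     (if R' 13 = 0 then R' 12 = Suc n
      else R' 13 \<le> n \<and> adj u (R' 13 - 1) \<and> price n M (R' 13 - 1) = R' 12 \<and> R' 12 < Suc n))"
  unfolding scan_min_def
  apply (rule runs_while[where f = "\<lambda>R' M'. R' 9" and b = 11 and
      I = "\<lambda>R' M'. M' = M \<and> (\<forall>k. k \<notin> {9..14} \<longrightarrow> R' k = R k) \<and> R' 9 \<le> n \<and>
        (\<forall>v<n. R' 9 \<le> v \<longrightarrow> adj u v \<longrightarrow> R' 12 \<le> price n M v) \<and>
        (if R' 13 = 0 then R' 12 = Suc n
         else R' 13 \<le> n \<and> adj u (R' 13 - 1) \<and> price n M (R' 13 - 1) = R' 12 \<and> R' 12 < Suc n)"])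
  subgoal using r by auto
  subgoal premises p for R' M'
  proof -
    from p(1) have M': "M' = M" and fr: "\<And>k. k \<notin> {9..14} \<Longrightarrow> R' k = R k" and le: "R' 9 \<le> n"
      and min: "\<And>v. v < n \<Longrightarrow> R' 9 \<le> v \<Longrightarrow> adj u v \<Longrightarrow> R' 12 \<le> price n M v"
      and best: "if R' 13 = 0 then R' 12 = Suc n
         else R' 13 \<le> n \<and> adj u (R' 13 - 1) \<and> price n M (R' 13 - 1) = R' 12 \<and> R' 12 < Suc n"
      by blast+
    obtain v where v: "R' 9 = Suc v" using p(2) by (cases "R' 9") auto
    have regs: "R' 0 = n" "R' 1 = Suc n" "R' 2 = 1" "R' 3 = 0" "R' 4 = n * n" "R' 8 = Suc u * n"
      using fr c r unfolding const_regs_def by auto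
    have adj: "adj u v \<longleftrightarrow> M (u * n + v) \<noteq> 0" using a u v le unfolding adjacency_def by auto
    have price: "M (Suc (n * n + v)) = price n M v" by (simp add: price_def)
    \<comment> \<open>The counter runs down, so the indices already scanned are those from
      \<open>v + 1\<close> on; this adds index \<open>v\<close>.\<close>
    have all: "(\<forall>w<n. v \<le> w \<longrightarrow> adj u w \<longrightarrow> x \<le> price n M w) \<longleftrightarrow>
       (\<forall>w<n. Suc v \<le> w \<longrightarrow> adj u w \<longrightarrow> x \<le> price n M w) \<and> (adj u v \<longrightarrow> x \<le> price n M v)" for x
      using v le by (metis Suc_le_eq le_neq_implies_less order_refl less_imp_le)
    show ?thesis
      using regs v fr le min best unfolding M'
      by (auto simp: adj all price intro: order_trans[OF less_imp_le] split: if_splits)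
  qed
  subgoal by auto
  subgoal using r by simp
  done

lemma adjacency_upd [simp]: "n * n \<le> a \<Longrightarrow> adjacency n adj (M(a := x)) = adjacency n adj M"
  unfolding adjacency_def using index_less by (metis fun_upd_other not_le)

lemma owner_upd_price [simp]: "v < n \<Longrightarrow> owner n (M(n * n + Suc v := x)) = owner n M"
  unfolding owner_def by auto

lemma owner_upd_owner [simp]: "owner n (M(n * n + n + Suc v := x)) = (owner n M)(v := x)"
  unfolding owner_def by auto

lemma price_upd_owner [simp]: "w < n \<Longrightarrow> price n (M(n * n + n + Suc v := x)) w = price n M w"
  unfolding price_def by auto

text \<open>Every bid raises a price and prices never exceed n + 1, so the slack bounds the number of
  bids.\<close>

definition slack :: "nat \<Rightarrow> (nat \<Rightarrow> nat) \<Rightarrow> nat" where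
  "slack n M = (\<Sum>v<n. Suc n - price n M v)"

lemma slack_le: "slack n M \<le> n * Suc n"
proof -
  have "slack n M \<le> (\<Sum>v<n. Suc n)" unfolding slack_def by (rule sum_mono) simp
  then show ?thesis by simp
qed

definition bid :: prog where
  "bid = SEQ (mul_prog 7) (SEQ (INSTR (SET 13 0)) (SEQ (INSTR (ADD 12 1 3)) (SEQ (INSTR (ADD 9 0 3))
    (SEQ scan_min
      (IFNZ 13
        (SEQ (INSTR (ADD 10 4 13)) (SEQ (INSTR (ADD 11 12 2)) (SEQ (INSTR (STORE 10 11))
        (SEQ (INSTR (ADD 10 5 13)) (SEQ (INSTR (LOAD 11 10)) (SEQ (INSTR (STORE 10 7))
        (INSTR (ADD 7 11 3))))))))
        (INSTR (ADD 7 3 3)))))))"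

text \<open>Register 7 holds the one active bidder plus one, the encoding of the owner array, so a
  bid simply moves the old owner there and 0 ends the chain of evictions. The last clause keeps the
  active bidder apart from the waiting ones \<open>{..<i}\<close>.\<close>

definition bidding ::
    "nat \<Rightarrow> (nat \<Rightarrow> nat \<Rightarrow> bool) \<Rightarrow> nat \<Rightarrow> (nat \<Rightarrow> nat) \<Rightarrow> (nat \<Rightarrow> nat) \<Rightarrow> bool" where
  "bidding n adj i R M \<longleftrightarrow> const_regs n R \<and> adjacency n adj M \<and> R 6 = i \<and>
     auction n adj (Suc n) (price n M) (owner n M) ({..<i} \<union> {u. R 7 = Suc u}) \<and>
     (\<forall>u. R 7 = Suc u \<longrightarrow> i \<le> u)"

text \<open>Giving up changes no price but empties register 7, hence the extra unit. A bid lowers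
  the slack, whatever it leaves in register 7.\<close>

definition bidding_measure :: "nat \<Rightarrow> (nat \<Rightarrow> nat) \<Rightarrow> (nat \<Rightarrow> nat) \<Rightarrow> nat" where
  "bidding_measure n R M = slack n M + (if R 7 = 0 then 0 else 1)"

lemma runs_bid:
  assumes b: "bidding n adj i R M" and "R 7 \<noteq> 0"
  shows "runs bid R M (n * 15 + 20)
    (\<lambda>R' M'. bidding n adj i R' M' \<and> bidding_measure n R' M' < bidding_measure n R M)"
    (is "runs _ _ _ _ ?Q")
proof -
  from b have c: "const_regs n R" and a: "adjacency n adj M" and i: "R 6 = i"
    and auc: "auction n adj (Suc n) (price n M) (owner n M) ({..<i} \<union> {u. R 7 = Suc u})"
    and fresh: "\<And>u. R 7 = Suc u \<Longrightarrow> i \<le> u"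
    unfolding bidding_def by blast+
  obtain u where u: "R 7 = Suc u" using \<open>R 7 \<noteq> 0\<close> by (cases "R 7") auto
  have "u < n" using auc u unfolding auction_def by auto
  have "u \<notin> {..<i}" using fresh[OF u] by simp
  then have C: "{..<i} \<union> {u. R 7 = Suc u} - {u} = {..<i}" using u by auto
  have tail: "runs (IFNZ 13
        (SEQ (INSTR (ADD 10 4 13)) (SEQ (INSTR (ADD 11 12 2)) (SEQ (INSTR (STORE 10 11))
        (SEQ (INSTR (ADD 10 5 13)) (SEQ (INSTR (LOAD 11 10)) (SEQ (INSTR (STORE 10 7))
        (INSTR (ADD 7 11 3))))))))
        (INSTR (ADD 7 3 3))) R' M' 8 ?Q"
    if M': "M' = M" and fr: "\<And>k. k \<notin> {8..14} \<Longrightarrow> R' k = R k"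
      and min: "\<And>v. v < n \<Longrightarrow> adj u v \<Longrightarrow> R' 12 \<le> price n M v"
      and best: "if R' 13 = 0 then R' 12 = Suc n
      else R' 13 \<le> n \<and> adj u (R' 13 - 1) \<and> price n M (R' 13 - 1) = R' 12 \<and> R' 12 < Suc n" for R' M'
  proof (cases "R' 13")
    case 0
    \<comment> \<open>Register 12 still has its start value n + 1, so every adjacent item is at the
      limit.\<close>
    then have "auction n adj (Suc n) (price n M) (owner n M) {..<i}"
      using auction_give_up[OF auc, of u] min best unfolding C by auto
    then show ?thesis using 0 fr c i a u \<open>R 7 \<noteq> 0\<close>
      unfolding M' bidding_def bidding_measure_def const_regs_def by simp
  next
    case (Suc v)
    then have v: "v < n" "adj u v" "price n M v = R' 12" "price n M v < Suc n" using best by auto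
    define M1 where "M1 = M(n * n + Suc v := Suc (price n M v))"
    define M2 where "M2 = M1(n * n + n + Suc v := Suc u)"
    have p2: "price n M2 w = ((price n M)(v := Suc (price n M v))) w" if "w < n" for w
      unfolding M2_def M1_def price_def using that by auto
    have o2: "owner n M2 = (owner n M)(v := Suc u)"
      unfolding M2_def M1_def owner_upd_owner using v(1) by (simp del: add_Suc_right)
    have "auction n adj (Suc n) ((price n M)(v := Suc (price n M v))) ((owner n M)(v := Suc u))
        ({..<i} \<union> {w. owner n M v = Suc w})"
      using auction_bid[OF auc, of u v] u v min unfolding C by simp
    then have auc2: "auction n adj (Suc n) (price n M2) (owner n M2) ({..<i} \<union> {w. owner n M v = Suc w})"
      using auction_cong[of n "price n M2" "(price n M)(v := Suc (price n M v))" "owner n M2" "owner n M2"]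
        p2 o2 by simp
    \<comment> \<open>An owner is never untreated, so the evicted bidder is not among the waiting
      ones.\<close>
    have fresh2: "i \<le> w" if "owner n M v = Suc w" for w
      using auc v(1) that unfolding auction_def by (meson UnCI lessThan_iff not_le)
    have "slack n M2 < slack n M"
      unfolding slack_def using v(1,4) p2
      by (intro sum_strict_mono_ex1) (auto intro!: bexI[of _ v])
    moreover have "M (Suc (n * n + n + v)) = owner n M v" by (simp add: owner_def)
    moreover have "M(Suc (n * n + v) := Suc (R' 12)) = M1" "M1(Suc (n * n + n + v) := Suc u) = M2"
      unfolding M1_def M2_def using v(3) by simp_all
    ultimately show ?thesis
      using Suc fr c i a u v(1) fresh2 auc2
      unfolding M' bidding_def bidding_measure_def const_regs_def
      by simp
  qed
  have le: "R 7 * 3 \<le> n * 3" using u \<open>u < n\<close> by simp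
  show ?thesis
    unfolding bid_def
    apply (rule runs_seq[OF runs_mul, where c = "n * 12 + 12"])
    subgoal using c by (simp add: const_regs_def)
    subgoal using c by (simp add: const_regs_def)
    subgoal by simp
    subgoal premises p for R' M'
      using p c u
      apply (simp add: const_regs_def)
      apply (rule runs_seq[OF runs_scan_min[where n = n and adj = adj and u = u], where c = 8])
      subgoal by (simp add: const_regs_def)
      subgoal using a by simp
      subgoal using \<open>u < n\<close> .
      subgoal by simp
      subgoal by simp
      subgoal by simp
      subgoal by simp
      subgoal premises q for R2 M2
      proof (rule tail)
        show "M2 = M" using q by simp
        show "R2 k = R k" if "k \<notin> {8..14}" for k
        proof -
          have "k \<notin> {9..14}" "k \<noteq> 8" "k \<noteq> 9" "k \<noteq> 12" "k \<noteq> 13" using that by auto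
          then show ?thesis using q by simp
        qed
      qed (use q in \<open>auto split: if_splits\<close>)
      subgoal by simp
      done
    subgoal using le by simp
    done
qed

section \<open>The complete auction\<close>

definition auction_prog :: prog where
  "auction_prog = SEQ (INSTR (ADD 6 0 3)) (WHILENZ 6
     (SEQ (INSTR (ADD 7 6 3)) (SEQ (INSTR (SUB 6 6 2)) (WHILENZ 7 bid))))"

text \<open>The slack is at most n(n + 1), register 7 adds 1, and a bid with its test costs
  \<open>n * 15 + 21\<close>. The full slack is charged to each of the \<open>n\<close> outer
  rounds, which is generous but polynomial.\<close>

definition bid_loop_time :: "nat \<Rightarrow> nat" where
  "bid_loop_time n = (n * Suc n + 1) * (n * 15 + 21) + 1"

lemma runs_bid_loop:
  assumes "bidding n adj i R M"
  shows "runs (WHILENZ 7 bid) R M (bid_loop_time n) (\<lambda>R' M'. bidding n adj i R' M' \<and> R' 7 = 0)"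
proof (rule runs_while[where I = "bidding n adj i" and f = "bidding_measure n"])
  show "bidding n adj i R M" by fact
  show "runs bid R M (n * 15 + 20)
    (\<lambda>R' M'. bidding n adj i R' M' \<and> bidding_measure n R' M' < bidding_measure n R M)"
    if "bidding n adj i R M" "R 7 \<noteq> 0" for R M using runs_bid that .
  have "bidding_measure n R M \<le> n * Suc n + 1"
    unfolding bidding_measure_def using slack_le[of n M] by simp
  then have "bidding_measure n R M * (n * 15 + 21) \<le> (n * Suc n + 1) * (n * 15 + 21)"
    by (rule mult_right_mono) simp
  moreover have "Suc (n * 15 + 20) = n * 15 + 21" by simp
  ultimately show "bidding_measure n R M * Suc (n * 15 + 20) + 1 \<le> bid_loop_time n"
    unfolding bid_loop_time_def by (metis add_right_mono)
qed auto

lemma runs_auction: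
  assumes c: "const_regs n R" and a: "adjacency n adj M" and z: "\<forall>a\<ge>n * n. M a = 0"
  shows "runs auction_prog R M (n * (bid_loop_time n + 3) + 2) (\<lambda>R' M'. const_regs n R' \<and>
     adjacency n adj M' \<and> auction n adj (Suc n) (price n M') (owner n M') {})"
proof -
  have zero: "price n M = (\<lambda>_. 0)" "owner n M = (\<lambda>_. 0)"
    unfolding price_def owner_def by (simp_all add: z)
  show ?thesis
    unfolding auction_prog_def
    apply simp
    apply (rule runs_while[where f = "\<lambda>R' M'. R' 6" and b = "bid_loop_time n + 2" and
      I = "\<lambda>R' M'. const_regs n R' \<and> adjacency n adj M' \<and>
        auction n adj (Suc n) (price n M') (owner n M') {..<R' 6}"])
    subgoal using c a by (simp add: const_regs_def auction_init zero)
    subgoal premises p for R' M'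
    proof -
      obtain i where i: "R' 6 = Suc i" using p by (cases "R' 6") auto
      define R2 where "R2 = R'(7 := Suc i, 6 := i)"
      \<comment> \<open>Moving bidder \<open>i\<close> from the counter into register 7 leaves the
        untreated set as it was.\<close>
      have "{..<i} \<union> {u. Suc i = Suc u} = {..<Suc i}" by auto
      then have "bidding n adj i R2 M'"
        using p i unfolding bidding_def const_regs_def R2_def by simp
      then have "runs (WHILENZ 7 bid) R2 M' (bid_loop_time n) (\<lambda>R2 M2. bidding n adj i R2 M2 \<and> R2 7 = 0)"
        by (rule runs_bid_loop)
      then have "runs (WHILENZ 7 bid) R2 M' (bid_loop_time n) (\<lambda>R2 M2. (const_regs n R2 \<and> adjacency n adj M2 \<and>
        auction n adj (Suc n) (price n M2) (owner n M2) {..<R2 6}) \<and> R2 6 < R' 6)"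
        by (rule runs_mono) (auto simp: bidding_def i)
      then show ?thesis using p i unfolding R2_def by (simp add: const_regs_def)
    qed
    subgoal by simp
    subgoal using c by (simp add: const_regs_def algebra_simps)
    done
qed

definition setup_prog :: prog where
  "setup_prog = SEQ (INSTR (SET 2 1)) (SEQ (INSTR (SET 3 0)) (SEQ (INSTR (ADD 1 0 2))
     (SEQ (mul_prog 0) (SEQ (INSTR (ADD 4 8 3)) (INSTR (ADD 5 4 0))))))"

lemma runs_setup:
  assumes "R 0 = n"
  shows "runs setup_prog R M (n * 3 + 8) (\<lambda>R' M'. const_regs n R' \<and> M' = M)"
  unfolding setup_prog_def using assms
  apply simp
  apply (rule runs_seq[OF runs_mul, where c = 2])
  apply (auto simp: const_regs_def)
  done

section \<open>Finding a number that is not a price\<close>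

definition gap_scan :: prog where
  "gap_scan = WHILENZ 9
     (SEQ (INSTR (ADD 10 4 9)) (SEQ (INSTR (LOAD 11 10)) (SEQ (INSTR (SUB 14 11 15))
     (SEQ (INSTR (SUB 17 15 11)) (SEQ (INSTR (ADD 14 14 17))
     (SEQ (IFNZ 14 (INSTR (SET 3 0)) (INSTR (SET 16 1))) (INSTR (SUB 9 9 2))))))))"

text \<open>Equality is tested by adding the truncated differences in both directions: the sum is 0
  only if price and candidate agree.\<close>

lemma runs_gap_scan:
  assumes c: "const_regs n R" and r: "R 9 = n" "R 16 = 0"
  shows "runs gap_scan R M (n * 9 + 1) (\<lambda>R' M'. M' = M \<and> const_regs n R' \<and> R' 15 = R 15 \<and>
     (R' 16 \<noteq> 0 \<longleftrightarrow> (\<exists>v<n. price n M v = R 15)))"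
  unfolding gap_scan_def
  apply (rule runs_while[where f = "\<lambda>R' M'. R' 9" and b = 8 and
      I = "\<lambda>R' M'. M' = M \<and> const_regs n R' \<and> R' 15 = R 15 \<and> R' 9 \<le> n \<and>
     (R' 16 \<noteq> 0 \<longleftrightarrow> (\<exists>v<n. R' 9 \<le> v \<and> price n M v = R 15))"])
  subgoal using c r by auto
  subgoal premises p for R' M'
  proof -
    obtain v where v: "R' 9 = Suc v" using p(2) by (cases "R' 9") auto
    have regs: "R' 0 = n" "R' 1 = Suc n" "R' 2 = 1" "R' 3 = 0" "R' 4 = n * n" "R' 5 = n * n + n"
      using p(1) unfolding const_regs_def by auto
    have price: "M (Suc (n * n + v)) = price n M v" by (simp add: price_def)
    have "v < n" using p v by simp
    then have ex: "(\<exists>w<n. v \<le> w \<and> price n M w = x) \<longleftrightarrow>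
       (\<exists>w<n. Suc v \<le> w \<and> price n M w = x) \<or> price n M v = x" for x
      by (metis Suc_le_eq le_neq_implies_less order_refl less_imp_le)
    show ?thesis
      using p v regs by (auto simp: const_regs_def price ex)
  qed
  subgoal by auto
  subgoal using r by simp
  done

definition find_gap :: prog where
  "find_gap = SEQ (INSTR (SET 15 0)) (SEQ (INSTR (SET 16 1)) (WHILENZ 16
     (SEQ (INSTR (ADD 15 15 2)) (SEQ (INSTR (SET 16 0)) (SEQ (INSTR (ADD 9 0 3)) gap_scan)))))"

lemma runs_find_gap:
  assumes c: "const_regs n R"
  shows "runs find_gap R M (Suc n * (n * 9 + 5) + 3) (\<lambda>R' M'. M' = M \<and> const_regs n R' \<and>
     R' 15 \<le> Suc n \<and> (\<forall>v<n. price n M v \<noteq> R' 15))"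
proof -
  \<comment> \<open>Pigeonhole: \<open>n\<close> vertices have at most \<open>n\<close> prices, so
    while 1 to \<open>h\<close> are all taken, the next candidate is still at most n + 1.\<close>
  have bound: "h \<le> n" if "{1..h} \<subseteq> price n M ` {..<n}" for h
    using card_mono[OF _ that] card_image_le[of "{..<n}" "price n M"] by simp
  show ?thesis
    unfolding find_gap_def
    apply simp
    \<comment> \<open>While the search continues the candidate is at most \<open>n\<close>, so
      \<open>Suc n - R' 15\<close> is positive and the drop to 0 on success is strict.\<close>
    apply (rule runs_while[where f = "\<lambda>R' M'. if R' 16 = 0 then 0 else Suc n - R' 15" and b = "n * 9 + 4" and
      I = "\<lambda>R' M'. M' = M \<and> const_regs n R' \<and> R' 15 \<le> Suc n \<and>
        (if R' 16 = 0 then \<forall>v<n. price n M v \<noteq> R' 15 else {1..R' 15} \<subseteq> price n M ` {..<n})"])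
    subgoal using c by (simp add: const_regs_def)
    subgoal premises p for R' M'
    proof -
      define h where "h = R' 15"
      have sub: "{1..h} \<subseteq> price n M ` {..<n}" using p h_def by simp
      have "{1..Suc h} = insert (Suc h) {1..h}" by auto
      then have sub': "{1..Suc h} \<subseteq> price n M ` {..<n}" if "\<exists>v<n. price n M v = Suc h"
        using sub that by (metis imageI insert_subset lessThan_iff)
      define R2 where "R2 = R'(15 := Suc h, 16 := 0, 9 := n)"
      have "runs gap_scan R2 M' (n * 9 + 1) (\<lambda>R3 M3. M3 = M' \<and> const_regs n R3 \<and> R3 15 = R2 15 \<and>
         (R3 16 \<noteq> 0 \<longleftrightarrow> (\<exists>v<n. price n M' v = R2 15)))"
        by (rule runs_gap_scan) (use p in \<open>auto simp: R2_def const_regs_def\<close>)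
      then have "runs gap_scan R2 M' (n * 9 + 1) (\<lambda>R3 M3. (M3 = M \<and> const_regs n R3 \<and> R3 15 \<le> Suc n \<and>
        (if R3 16 = 0 then \<forall>v<n. price n M v \<noteq> R3 15 else {1..R3 15} \<subseteq> price n M ` {..<n})) \<and>
        (if R3 16 = 0 then 0 else Suc n - R3 15) < (if R' 16 = 0 then 0 else Suc n - R' 15))"
        by (rule runs_mono) (use p bound[OF sub] bound[OF sub'] sub' in \<open>auto simp: R2_def h_def\<close>)
      then show ?thesis using p by (simp add: const_regs_def R2_def h_def)
    qed
    subgoal by simp
    subgoal by simp
    done
qed

section \<open>Reading off the independent set\<close>

definition flag_scan :: prog where
  "flag_scan = WHILENZ 9
     (SEQ (INSTR (ADD 10 8 9)) (SEQ (INSTR (SUB 10 10 1)) (SEQ (INSTR (LOAD 11 10))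
     (SEQ (IFNZ 11
        (SEQ (INSTR (ADD 10 4 9)) (SEQ (INSTR (LOAD 11 10)) (SEQ (INSTR (SUB 14 11 15))
          (IFNZ 14 (INSTR (SET 3 0)) (INSTR (SET 12 0))))))
        (INSTR (SET 3 0)))
     (INSTR (SUB 9 9 2))))))"

lemma runs_flag_scan:
  assumes c: "const_regs n R" and a: "adjacency n adj M" and u: "u < n"
    and r: "R 8 = Suc u * n" "R 9 = n"
  shows "runs flag_scan R M (n * 11 + 1) (\<lambda>R' M'. M' = M \<and> (\<forall>k. k \<notin> {9..14} \<longrightarrow> R' k = R k) \<and>
     R' 12 = (if \<forall>v<n. adj u v \<longrightarrow> R 15 < price n M v then R 12 else 0))"
  unfolding flag_scan_def
  apply (rule runs_while[where f = "\<lambda>R' M'. R' 9" and b = 10 and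
      I = "\<lambda>R' M'. M' = M \<and> (\<forall>k. k \<notin> {9..14} \<longrightarrow> R' k = R k) \<and> R' 9 \<le> n \<and>
     R' 12 = (if \<forall>v<n. R' 9 \<le> v \<longrightarrow> adj u v \<longrightarrow> R 15 < price n M v then R 12 else 0)"])
  subgoal using r by auto
  subgoal premises p for R' M'
  proof -
    from p(1) have M': "M' = M" and fr: "\<And>k. k \<notin> {9..14} \<Longrightarrow> R' k = R k" and le: "R' 9 \<le> n"
      and flag: "R' 12 = (if \<forall>v<n. R' 9 \<le> v \<longrightarrow> adj u v \<longrightarrow> R 15 < price n M v then R 12 else 0)"
      by blast+
    obtain v where v: "R' 9 = Suc v" using p(2) by (cases "R' 9") auto
    have regs: "R' 0 = n" "R' 1 = Suc n" "R' 2 = 1" "R' 3 = 0" "R' 4 = n * n" "R' 8 = Suc u * n"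
      using fr c r unfolding const_regs_def by auto
    have adj: "adj u v \<longleftrightarrow> M (u * n + v) \<noteq> 0" using a u v le unfolding adjacency_def by auto
    have price: "M (Suc (n * n + v)) = price n M v" by (simp add: price_def)
    have all: "(\<forall>w<n. v \<le> w \<longrightarrow> adj u w \<longrightarrow> R 15 < price n M w) \<longleftrightarrow>
       (\<forall>w<n. Suc v \<le> w \<longrightarrow> adj u w \<longrightarrow> R 15 < price n M w) \<and> (adj u v \<longrightarrow> R 15 < price n M v)"
      using v le by (metis Suc_le_eq le_neq_implies_less order_refl less_imp_le)
    have "R' 15 = R 15" using fr by simp
    then show ?thesis
      using regs v fr le flag unfolding M' by (simp add: adj all price)
  qed
  subgoal by auto
  subgoal using r by simp
  done

definition select_prog :: prog where
  "select_prog = SEQ (INSTR (ADD 6 0 3)) (WHILENZ 6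
     (SEQ (INSTR (SET 12 1)) (SEQ (INSTR (ADD 10 4 6)) (SEQ (INSTR (LOAD 11 10))
     (SEQ (INSTR (SUB 14 11 15)) (SEQ (IFNZ 14 (INSTR (SET 12 0)) (INSTR (SET 3 0)))
     (SEQ (mul_prog 6) (SEQ (INSTR (ADD 9 0 3)) (SEQ flag_scan
     (SEQ (INSTR (ADD 10 5 6)) (SEQ (INSTR (STORE 10 12)) (INSTR (SUB 6 6 2)))))))))))))"

lemma runs_select:
  assumes c: "const_regs n R" and a: "adjacency n adj M"
  shows "runs select_prog R M (n * (n * 14 + 16) + 2) (\<lambda>R' M'. const_regs n R' \<and>
     (\<forall>u<n. owner n M' u =
        (if price n M u \<le> R 15 \<and> (\<forall>v<n. adj u v \<longrightarrow> R 15 < price n M v) then 1 else 0)))"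
proof -
  define flag where "flag u =
      (if price n M u \<le> R 15 \<and> (\<forall>v<n. adj u v \<longrightarrow> R 15 < price n M v) then 1 else 0 :: nat)" for u
  let ?I = "\<lambda>R' M'. const_regs n R' \<and> adjacency n adj M' \<and> R' 15 = R 15 \<and> R' 6 \<le> n \<and>
     (\<forall>v<n. price n M' v = price n M v) \<and> (\<forall>u<n. R' 6 \<le> u \<longrightarrow> owner n M' u = flag u)"
  show ?thesis
    unfolding select_prog_def flag_def[symmetric]
    apply simp
    apply (rule runs_while[where f = "\<lambda>R' M'. R' 6" and b = "n * 14 + 15" and I = ?I])
    subgoal using c a by (simp add: const_regs_def)
    subgoal premises p for R' M'
    proof -
      obtain u where u: "R' 6 = Suc u" using p(2) by (cases "R' 6") auto
      let ?Q = "\<lambda>R2 M2. ?I R2 M2 \<and> R2 6 < Suc u"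
      have "u < n" using p u by simp
      have price: "M' (Suc (n * n + u)) = price n M u"
        using p \<open>u < n\<close> by (simp add: price_def)
      \<comment> \<open>The flag after the test of the vertex's own price; the scan of its row can
        only clear it.\<close>
      define x :: nat where "x = (if price n M u \<le> R 15 then 1 else 0)"
      have tail: "runs (SEQ (INSTR (ADD 10 5 6)) (SEQ (INSTR (STORE 10 12)) (INSTR (SUB 6 6 2)))) R3 M3 3 ?Q"
        if "M3 = M'" and fr: "\<And>k. k \<notin> {8..14} \<Longrightarrow> R3 k = R' k" and f: "R3 12 = flag u" for R3 M3
      proof -
        have upd: "M'(Suc (n * n + n + u) := y) = M'(n * n + n + Suc u := y)" for y by simp
        have own: "(\<forall>w<n. u \<le> w \<longrightarrow> ((owner n M')(u := flag u)) w = flag w) \<longleftrightarrow>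
            (\<forall>w<n. Suc u \<le> w \<longrightarrow> owner n M' w = flag w)"
          by (auto simp: Suc_le_eq)
        show ?thesis
          using p u fr f \<open>M3 = M'\<close>
          by (auto simp: const_regs_def upd own simp del: add_Suc_right)
      qed
      have rest: "runs (SEQ (mul_prog 6) (SEQ (INSTR (ADD 9 0 3)) (SEQ flag_scan
          (SEQ (INSTR (ADD 10 5 6)) (SEQ (INSTR (STORE 10 12)) (INSTR (SUB 6 6 2)))))))
          R2 M' (9 + n * 14) ?Q"
        if fr: "\<And>k. k \<notin> {8..14} \<Longrightarrow> R2 k = R' k" and f: "R2 12 = x" for R2
      proof (rule runs_seq[OF runs_mul, where c = "n * 11 + 5"])
        have regs: "R2 0 = n" "R2 1 = Suc n" "R2 2 = 1" "R2 3 = 0" "R2 4 = n * n" "R2 5 = n * n + n"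
          "R2 6 = Suc u" "R2 15 = R 15"
          using p u fr by (simp_all add: const_regs_def)
        show "R2 2 = 1" "R2 3 = 0" "(6::nat) < 8" using regs by simp_all
        show "R2 6 * 3 + 3 + (n * 11 + 5) \<le> 9 + n * 14" using regs \<open>u < n\<close> by simp
        fix R3 M3 assume R3: "R3 = R2(8 := R2 6 * R2 0, 9 := 0) \<and> M3 = M'"
        define R4 where "R4 = R2(8 := Suc u * n, 9 := n)"
        have "runs (SEQ flag_scan (SEQ (INSTR (ADD 10 5 6)) (SEQ (INSTR (STORE 10 12)) (INSTR (SUB 6 6 2)))))
          R4 M' (4 + n * 11) ?Q"
        proof (rule runs_seq[OF runs_flag_scan[where n = n and adj = adj and u = u], where c = 3])
          fix R5 M5 assume R5: "M5 = M' \<and> (\<forall>k. k \<notin> {9..14} \<longrightarrow> R5 k = R4 k) \<and>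
            R5 12 = (if \<forall>v<n. adj u v \<longrightarrow> R4 15 < price n M' v then R4 12 else 0)"
          show "runs (SEQ (INSTR (ADD 10 5 6)) (SEQ (INSTR (STORE 10 12)) (INSTR (SUB 6 6 2)))) R5 M5 3 ?Q"
          proof (rule tail)
            show "M5 = M'" using R5 by blast
            show "R5 k = R' k" if "k \<notin> {8..14}" for k
            proof -
              have "k \<notin> {9..14}" "k \<noteq> 8" "k \<noteq> 9" using that by auto
              then show ?thesis using R5 fr[OF that] by (simp add: R4_def)
            qed
            show "R5 12 = flag u"
              using R5 p regs f by (simp add: R4_def flag_def x_def)
          qed
        qed (use p regs \<open>u < n\<close> in \<open>simp_all add: R4_def const_regs_def\<close>)
        then show "runs (SEQ (INSTR (ADD 9 0 3)) (SEQ flag_scan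
          (SEQ (INSTR (ADD 10 5 6)) (SEQ (INSTR (STORE 10 12)) (INSTR (SUB 6 6 2)))))) R3 M3 (n * 11 + 5) ?Q"
          using R3 regs by (simp add: R4_def)
      qed
      show ?thesis
      proof -
        have "R' 0 = n" "R' 2 = 1" "R' 3 = 0" "R' 4 = n * n" "R' 15 = R 15"
          using p by (simp_all add: const_regs_def)
        then show ?thesis
          using u price by simp (intro conjI impI; rule runs_mono[OF rest]; force simp: x_def)
      qed
    qed
    subgoal by simp
    subgoal using c by (simp add: const_regs_def algebra_simps)
    done
qed

text \<open>The answer is written over the owner array first, because the cells of the output still
  hold the adjacency matrix while it is needed.\<close>

definition copy_prog :: prog where
  "copy_prog = SEQ (INSTR (ADD 9 0 3)) (WHILENZ 9
     (SEQ (INSTR (ADD 10 5 9)) (SEQ (INSTR (LOAD 11 10)) (SEQ (INSTR (SUB 10 9 2))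
     (SEQ (INSTR (STORE 10 11)) (INSTR (SUB 9 9 2)))))))"

lemma runs_copy:
  assumes c: "const_regs n R"
  shows "runs copy_prog R M (n * 6 + 2) (\<lambda>R' M'. const_regs n R' \<and> (\<forall>v<n. M' v = owner n M v))"
  unfolding copy_prog_def
  apply simp
  apply (rule runs_while[where f = "\<lambda>R' M'. R' 9" and b = 5 and
    I = "\<lambda>R' M'. const_regs n R' \<and> R' 9 \<le> n \<and> (\<forall>v<n. owner n M' v = owner n M v) \<and>
      (\<forall>v<n. R' 9 \<le> v \<longrightarrow> M' v = owner n M v)"])
  subgoal using c by (simp add: const_regs_def)
  subgoal premises p for R' M'
  proof -
    obtain v where v: "R' 9 = Suc v" using p(2) by (cases "R' 9") auto
    then have "v < n" using p by simp
    \<comment> \<open>Targets lie below \<open>n\<close>, sources beyond n * n + n, so no write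
      disturbs what is still to be read.\<close>
    have own: "owner n (M'(v := x)) = owner n M'" for x
      using \<open>v < n\<close> by (auto simp: owner_def)
    have "M' (Suc (n * n + n + v)) = owner n M v"
      using p \<open>v < n\<close> by (simp add: owner_def)
    then show ?thesis
      using p v by (auto simp: const_regs_def own)
  qed
  subgoal by simp
  subgoal using c by (simp add: const_regs_def)
  done

section \<open>Complementing bit strings and matrices\<close>

definition flip_prog :: prog where
  "flip_prog = WHILENZ 9
     (SEQ (INSTR (SUB 10 9 2)) (SEQ (INSTR (LOAD 11 10)) (SEQ (INSTR (SUB 11 2 11))
     (SEQ (INSTR (STORE 10 11)) (INSTR (SUB 9 9 2))))))"

text \<open>The length is taken from register 9, so one loop serves both the \<open>n\<close> answer
  bits for covers and the n * n matrix entries for cliques.\<close>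

lemma runs_flip:
  assumes c: "const_regs n R"
  shows "runs flip_prog R M (R 9 * 6 + 1) (\<lambda>R' M'. const_regs n R' \<and>
     M' = (\<lambda>a. if a < R 9 then 1 - M a else M a))"
  unfolding flip_prog_def
  apply (rule runs_while[where f = "\<lambda>R' M'. R' 9" and b = 5 and
    I = "\<lambda>R' M'. const_regs n R' \<and> R' 9 \<le> R 9 \<and>
      (\<forall>a. M' a = (if R' 9 \<le> a \<and> a < R 9 then 1 - M a else M a))"])
  subgoal using c by simp
  subgoal premises p for R' M'
  proof -
    obtain v where v: "R' 9 = Suc v" using p(2) by (cases "R' 9") auto
    show ?thesis
      using p v by (auto simp: const_regs_def)
  qed
  subgoal by (auto simp: fun_eq_iff)
  subgoal by simp
  done

definition diagonal_prog :: prog where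
  "diagonal_prog = SEQ (INSTR (ADD 9 0 3)) (SEQ (INSTR (ADD 10 5 3)) (WHILENZ 9
     (SEQ (INSTR (SUB 10 10 1)) (SEQ (INSTR (STORE 10 3)) (INSTR (SUB 9 9 2))))))"

text \<open>Inverting a loop-free matrix puts ones on the diagonal, which must be erased. Diagonal
  addresses are multiples of n + 1, and register 5 holds n(n + 1), one stride beyond the
  last.\<close>

lemma runs_diagonal:
  assumes c: "const_regs n R"
  shows "runs diagonal_prog R M (n * 4 + 3) (\<lambda>R' M'. const_regs n R' \<and>
     M' = (\<lambda>a. if \<exists>u<n. a = u * Suc n then 0 else M a))"
  unfolding diagonal_prog_def
  apply simp
  apply (rule runs_while[where f = "\<lambda>R' M'. R' 9" and b = 3 and
    I = "\<lambda>R' M'. const_regs n R' \<and> R' 9 \<le> n \<and> R' 10 = R' 9 * Suc n \<and>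
      (\<forall>a. M' a = (if \<exists>u<n. R' 9 \<le> u \<and> a = u * Suc n then 0 else M a))"])
  subgoal using c by (auto simp: const_regs_def dest: leD)
  subgoal premises p for R' M'
  proof -
    obtain v where v: "R' 9 = Suc v" using p(2) by (cases "R' 9") auto
    then have "v < n" using p by simp
    then have ex: "(\<exists>u<n. v \<le> u \<and> a = u * Suc n) \<longleftrightarrow>
       a = v * Suc n \<or> (\<exists>u<n. Suc v \<le> u \<and> a = u * Suc n)" for a
      by (metis Suc_le_eq le_neq_implies_less order_refl less_imp_le)
    show ?thesis
      using p v by (auto simp: const_regs_def ex simp del: mult_Suc_right)
  qed
  subgoal by (auto simp: fun_eq_iff)
  subgoal using c by (simp add: const_regs_def)
  done

definition independent_prog :: prog where
  "independent_prog = SEQ auction_prog (SEQ find_gap (SEQ select_prog copy_prog))"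

definition independent_time :: "nat \<Rightarrow> nat" where
  "independent_time n = (n * (bid_loop_time n + 3) + 2) + ((Suc n * (n * 9 + 5) + 3) +
     ((n * (n * 14 + 16) + 2) + (n * 6 + 2)))"

lemma runs_independent:
  assumes g: "simple_graph n E" and c: "const_regs n R"
    and a: "adjacency n (\<lambda>u v. {u, v} \<in> E) M" and z: "\<forall>a\<ge>n * n. M a = 0"
  shows "runs independent_prog R M (independent_time n) (\<lambda>R' M'. const_regs n R' \<and>
     (\<exists>I. near_max_independent n E I \<and> (\<forall>v<n. M' v = (if v \<in> I then 1 else 0))))"
  unfolding independent_prog_def independent_time_def
proof (rule runs_seq[OF runs_auction[OF c a z] _ order_refl], elim conjE)
  fix R1 M1
  assume c1: "const_regs n R1" and a1: "adjacency n (\<lambda>u v. {u, v} \<in> E) M1"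
    and auc: "auction n (\<lambda>u v. {u, v} \<in> E) (Suc n) (price n M1) (owner n M1) {}"
  show "runs (SEQ find_gap (SEQ select_prog copy_prog)) R1 M1
     ((Suc n * (n * 9 + 5) + 3) + ((n * (n * 14 + 16) + 2) + (n * 6 + 2)))
     (\<lambda>R' M'. const_regs n R' \<and>
     (\<exists>I. near_max_independent n E I \<and> (\<forall>v<n. M' v = (if v \<in> I then 1 else 0))))"
  proof (rule runs_seq[OF runs_find_gap[OF c1] _ order_refl], elim conjE)
    fix R2 M2 assume "M2 = M1" and c2: "const_regs n R2" and h: "R2 15 \<le> Suc n"
      and gap: "\<forall>v<n. price n M1 v \<noteq> R2 15"
    define I where "I = {u. u < n \<and> price n M1 u \<le> R2 15 \<and> (\<forall>w<n. {u, w} \<in> E \<longrightarrow> R2 15 < price n M1 w)}"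
    have I: "near_max_independent n E I"
      unfolding I_def using auction_finished[OF g auc h] gap by blast
    show "runs (SEQ select_prog copy_prog) R2 M2 ((n * (n * 14 + 16) + 2) + (n * 6 + 2))
     (\<lambda>R' M'. const_regs n R' \<and>
     (\<exists>I. near_max_independent n E I \<and> (\<forall>v<n. M' v = (if v \<in> I then 1 else 0))))"
      unfolding \<open>M2 = M1\<close>
    proof (rule runs_seq[OF runs_select[OF c2 a1] _ order_refl], elim conjE)
      fix R3 M3 assume c3: "const_regs n R3" and o: "\<forall>u<n. owner n M3 u =
        (if price n M1 u \<le> R2 15 \<and> (\<forall>v<n. {u, v} \<in> E \<longrightarrow> R2 15 < price n M1 v) then 1 else 0)"
      have "\<forall>v<n. owner n M3 v = (if v \<in> I then 1 else 0)"
        unfolding I_def using o by simp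
      with I show "runs copy_prog R3 M3 (n * 6 + 2) (\<lambda>R' M'. const_regs n R' \<and>
     (\<exists>I. near_max_independent n E I \<and> (\<forall>v<n. M' v = (if v \<in> I then 1 else 0))))"
        by (intro runs_mono[OF runs_copy[OF c3]]) auto
    qed
  qed
qed

section \<open>Polynomial-time approximation algorithms\<close>

definition poly_bounded :: "(nat \<Rightarrow> nat) \<Rightarrow> bool" where
  "poly_bounded f \<longleftrightarrow> (\<exists>p. \<forall>n. f n \<le> poly p n)"

lemma poly_bounded_const: "poly_bounded (\<lambda>_. c)"
  unfolding poly_bounded_def by (intro exI[of _ "[:c:]"]) simp

lemma poly_bounded_id: "poly_bounded (\<lambda>n. n)"
  unfolding poly_bounded_def by (intro exI[of _ "[:0, 1:]"]) simp

lemma poly_bounded_add: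
  assumes "poly_bounded f" "poly_bounded g"
  shows "poly_bounded (\<lambda>n. f n + g n)"
proof -
  obtain p q where "\<And>n. f n \<le> poly p n" "\<And>n. g n \<le> poly q n"
    using assms unfolding poly_bounded_def by blast
  then show ?thesis unfolding poly_bounded_def by (intro exI[of _ "p + q"]) (simp add: add_mono)
qed

lemma poly_bounded_mult:
  assumes "poly_bounded f" "poly_bounded g"
  shows "poly_bounded (\<lambda>n. f n * g n)"
proof -
  obtain p q where "\<And>n. f n \<le> poly p n" "\<And>n. g n \<le> poly q n"
    using assms unfolding poly_bounded_def by blast
  then show ?thesis unfolding poly_bounded_def by (intro exI[of _ "p * q"]) (simp add: mult_mono)
qed

lemma poly_bounded_Suc: "poly_bounded f \<Longrightarrow> poly_bounded (\<lambda>n. Suc (f n))"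
  using poly_bounded_add[OF _ poly_bounded_const[of 1]] by simp

lemmas poly_bounded_intros =
  poly_bounded_const poly_bounded_id poly_bounded_add poly_bounded_mult poly_bounded_Suc

lemma poly_bounded_independent_time: "poly_bounded independent_time"
proof -
  have "poly_bounded (\<lambda>n. independent_time n)"
    unfolding independent_time_def bid_loop_time_def by (intro poly_bounded_intros)
  then show ?thesis .
qed

text \<open>The program comes first; \<open>A\<close> is then chosen as the set it leaves in memory.
  As execution is deterministic and the output cells determine the set, the choice is forced on
  simple graphs.\<close>

lemma polytime_computable_if_runs:
  assumes "\<And>n E. simple_graph n E \<Longrightarrow>
      runs P (fst (input_state n E)) (snd (input_state n E)) (f n)
        (\<lambda>R M. \<exists>S\<subseteq>{..<n}. good n E S \<and> (\<forall>v<n. M v = (if v \<in> S then 1 else 0)))"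
    and "poly_bounded f"
  shows "\<exists>A. polytime_computable A \<and> (\<forall>n E. simple_graph n E \<longrightarrow> A n E \<subseteq> {..<n} \<and> good n E (A n E))"
proof -
  obtain p where p: "\<And>n. f n \<le> poly p n" using assms(2) unfolding poly_bounded_def by blast
  have "\<exists>S. simple_graph n E \<longrightarrow> S \<subseteq> {..<n} \<and> good n E S \<and>
      (\<exists>t s. exec P (input_state n E) t s \<and> t \<le> poly p n \<and> output_is n S s)" for n E
  proof (cases "simple_graph n E")
    case True
    obtain t R M S where "exec P (input_state n E) t (R, M)" "t \<le> f n" "S \<subseteq> {..<n}" "good n E S"
      "\<forall>v<n. M v = (if v \<in> S then 1 else 0)"
      using assms(1)[OF True] unfolding runs_def by auto
    then show ?thesis using p[of n] unfolding output_is_def by (metis le_trans snd_conv)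
  qed auto
  then obtain A where A: "\<And>n E. simple_graph n E \<Longrightarrow> A n E \<subseteq> {..<n} \<and> good n E (A n E) \<and>
      (\<exists>t s. exec P (input_state n E) t s \<and> t \<le> poly p n \<and> output_is n (A n E) s)"
    by metis
  have "polytime_computable A" unfolding polytime_computable_def
    by (intro exI[of _ P] exI[of _ p]) (use A in blast)
  then show ?thesis using A by blast
qed

lemma hamming_approximation_half:
  assumes "\<And>n E. simple_graph n E \<Longrightarrow>
    A n E \<subseteq> {..<n} \<and> (\<exists>T. opt n E T \<and> 2 * hamming_distance (A n E) T \<le> n)"
  shows "hamming_approximation (\<lambda>n. real n / 2) opt A"
  unfolding hamming_approximation_def
proof (intro allI impI)
  fix n E assume "simple_graph n E"
  then obtain T where T: "A n E \<subseteq> {..<n}" "opt n E T" "2 * hamming_distance (A n E) T \<le> n"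
    using assms by blast
  from T(3) have "real (hamming_distance (A n E) T) \<le> real n / 2" by linarith
  with T show "A n E \<subseteq> {..<n} \<and> (\<exists>T. opt n E T \<and> real (hamming_distance (A n E) T) \<le> real n / 2)"
    by blast
qed

lemma adjacency_input:
  "adjacency n (\<lambda>u v. {u, v} \<in> E) (snd (input_state n E))"
  unfolding adjacency_def input_state_def using index_less by auto

lemma input_state_simps:
  "fst (input_state n E) 0 = n" "n * n \<le> a \<Longrightarrow> snd (input_state n E) a = 0"
  unfolding input_state_def by auto

lemma independent_set_algorithm:
  "\<exists>A. polytime_computable A \<and> hamming_approximation (\<lambda>n. real n / 2) max_independent_set A"
proof -
  define P where "P = SEQ setup_prog independent_prog"
  have "\<exists>A. polytime_computable A \<and> (\<forall>n E. simple_graph n E \<longrightarrow> A n E \<subseteq> {..<n} \<and>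
      (\<exists>T. max_independent_set n E T \<and> 2 * hamming_distance (A n E) T \<le> n))"
  proof (rule polytime_computable_if_runs[where P = P])
    show "runs P (fst (input_state n E)) (snd (input_state n E)) ((n * 3 + 8) + independent_time n)
      (\<lambda>R M. \<exists>S\<subseteq>{..<n}. (\<exists>T. max_independent_set n E T \<and> 2 * hamming_distance S T \<le> n) \<and>
        (\<forall>v<n. M v = (if v \<in> S then 1 else 0)))" if g: "simple_graph n E" for n E
      unfolding P_def
    proof (rule runs_seq[OF runs_setup _ order_refl])
      fix R M assume "const_regs n R \<and> M = snd (input_state n E)"
      then show "runs independent_prog R M (independent_time n)
        (\<lambda>R M. \<exists>S\<subseteq>{..<n}. (\<exists>T. max_independent_set n E T \<and> 2 * hamming_distance S T \<le> n) \<and>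
        (\<forall>v<n. M v = (if v \<in> S then 1 else 0)))"
        by (intro runs_mono[OF runs_independent[OF g]])
          (auto simp: near_max_independent_def adjacency_input input_state_simps)
    qed (simp add: input_state_simps)
    show "poly_bounded (\<lambda>n. (n * 3 + 8) + independent_time n)"
      by (intro poly_bounded_intros poly_bounded_independent_time)
  qed
  then show ?thesis using hamming_approximation_half by blast
qed

lemma vertex_cover_algorithm:
  "\<exists>A. polytime_computable A \<and> hamming_approximation (\<lambda>n. real n / 2) min_vertex_cover A"
proof -
  define P where "P = SEQ setup_prog (SEQ independent_prog (SEQ (INSTR (ADD 9 0 3)) flip_prog))"
  have "\<exists>A. polytime_computable A \<and> (\<forall>n E. simple_graph n E \<longrightarrow> A n E \<subseteq> {..<n} \<and>
      (\<exists>T. min_vertex_cover n E T \<and> 2 * hamming_distance (A n E) T \<le> n))"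
  proof (rule polytime_computable_if_runs[where P = P])
    show "runs P (fst (input_state n E)) (snd (input_state n E))
      ((n * 3 + 8) + (independent_time n + (n * 6 + 2)))
      (\<lambda>R M. \<exists>S\<subseteq>{..<n}. (\<exists>T. min_vertex_cover n E T \<and> 2 * hamming_distance S T \<le> n) \<and>
        (\<forall>v<n. M v = (if v \<in> S then 1 else 0)))"
      (is "runs _ _ _ _ ?Q") if g: "simple_graph n E" for n E
      unfolding P_def
    proof (rule runs_seq[OF runs_setup _ order_refl])
      fix R M assume RM: "const_regs n R \<and> M = snd (input_state n E)"
      show "runs (SEQ independent_prog (SEQ (INSTR (ADD 9 0 3)) flip_prog)) R M
        (independent_time n + (n * 6 + 2)) ?Q"
      proof (rule runs_seq[OF runs_independent[OF g] _ order_refl])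
        fix R' M' :: "nat \<Rightarrow> nat" assume "const_regs n R' \<and>
          (\<exists>I. near_max_independent n E I \<and> (\<forall>v<n. M' v = (if v \<in> I then 1 else 0)))"
        then obtain I T where c: "const_regs n R'" and I: "I \<subseteq> {..<n}" "max_independent_set n E T"
          "2 * hamming_distance I T \<le> n" and M': "\<forall>v<n. M' v = (if v \<in> I then 1 else 0)"
          unfolding near_max_independent_def by blast
        have "T \<subseteq> {..<n}" using I(2)
          unfolding max_independent_set_def is_arg_max_linorder independent_set_def by blast
        then have good: "\<exists>T. min_vertex_cover n E T \<and> 2 * hamming_distance ({..<n} - I) T \<le> n"
          using min_vertex_cover_complement[OF g I(2)] I(1,3) hamming_distance_complement by metis
        have c2: "const_regs n (R'(9 := n))" using c by (simp add: const_regs_def)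
        have "runs flip_prog (R'(9 := n)) M' (n * 6 + 1) ?Q"
          by (rule runs_mono[OF runs_flip[OF c2]])
            (use good M' in \<open>simp, simp, intro exI[of _ "{..<n} - I"], auto\<close>)
        then show "runs (SEQ (INSTR (ADD 9 0 3)) flip_prog) R' M' (n * 6 + 2) ?Q"
          using c by (simp add: const_regs_def)
      qed (use RM in \<open>auto simp: adjacency_input input_state_simps\<close>)
    qed (simp add: input_state_simps)
    show "poly_bounded (\<lambda>n. (n * 3 + 8) + (independent_time n + (n * 6 + 2)))"
      by (intro poly_bounded_intros poly_bounded_independent_time)
  qed
  then show ?thesis using hamming_approximation_half by blast
qed

lemma adjacency_complement_graph:
  assumes "adjacency n (\<lambda>u v. {u, v} \<in> E) M"
  shows "adjacency n (\<lambda>u v. {u, v} \<in> complement_graph n E)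
    (\<lambda>a. if \<exists>w<n. a = w * Suc n then 0 else if a < n * n then 1 - M a else M a)"
  unfolding adjacency_def
proof (intro allI impI)
  fix u v assume uv: "u < n" "v < n"
  \<comment> \<open>Division by \<open>n\<close> recovers row and column, and both equal
    \<open>w\<close> for the address w * n + w.\<close>
  have "(\<exists>w<n. u * n + v = w * Suc n) \<longleftrightarrow> u = v"
  proof
    assume "\<exists>w<n. u * n + v = w * Suc n"
    then obtain w where "w < n" "u * n + v = w * n + w" by auto
    then have "(u * n + v) div n = (w * n + w) div n" "(u * n + v) mod n = (w * n + w) mod n"
      by simp_all
    then show "u = v" using uv \<open>w < n\<close> by simp
  qed (use uv in auto)
  then show "({u, v} \<in> complement_graph n E) \<longleftrightarrow>
    (if \<exists>w<n. u * n + v = w * Suc n then 0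
     else if u * n + v < n * n then 1 - M (u * n + v) else M (u * n + v)) \<noteq> 0"
    using assms uv index_less[OF uv] unfolding adjacency_def complement_graph_iff by auto
qed

lemma clique_algorithm:
  "\<exists>A. polytime_computable A \<and> hamming_approximation (\<lambda>n. real n / 2) max_clique A"
proof -
  define P where "P = SEQ setup_prog (SEQ (INSTR (ADD 9 4 3))
    (SEQ flip_prog (SEQ diagonal_prog independent_prog)))"
  have "\<exists>A. polytime_computable A \<and> (\<forall>n E. simple_graph n E \<longrightarrow> A n E \<subseteq> {..<n} \<and>
      (\<exists>T. max_clique n E T \<and> 2 * hamming_distance (A n E) T \<le> n))"
  proof (rule polytime_computable_if_runs[where P = P])
    show "runs P (fst (input_state n E)) (snd (input_state n E))
      ((n * 3 + 8) + Suc ((n * n * 6 + 1) + ((n * 4 + 3) + independent_time n)))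
      (\<lambda>R M. \<exists>S\<subseteq>{..<n}. (\<exists>T. max_clique n E T \<and> 2 * hamming_distance S T \<le> n) \<and>
        (\<forall>v<n. M v = (if v \<in> S then 1 else 0)))"
      (is "runs _ _ ?M _ ?Q") for n E
      unfolding P_def
    proof (rule runs_seq[OF runs_setup _ order_refl])
      fix R M assume RM: "const_regs n R \<and> M = ?M"
      define R1 where "R1 = R(9 := n * n)"
      have c1: "const_regs n R1" and R1: "R1 9 = n * n"
        using RM by (simp_all add: const_regs_def R1_def)
      have "runs (SEQ flip_prog (SEQ diagonal_prog independent_prog)) R1 M
        ((n * n * 6 + 1) + ((n * 4 + 3) + independent_time n)) ?Q"
      proof (rule runs_seq[OF runs_flip[OF c1, unfolded R1] _ order_refl])
        fix R2 M2 assume 2: "const_regs n R2 \<and> M2 = (\<lambda>a. if a < n * n then 1 - M a else M a)"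
        then have c2: "const_regs n R2" by blast
        show "runs (SEQ diagonal_prog independent_prog) R2 M2 ((n * 4 + 3) + independent_time n) ?Q"
        proof (rule runs_seq[OF runs_diagonal[OF c2] _ order_refl])
          fix R3 M3 assume 3: "const_regs n R3 \<and> M3 = (\<lambda>a. if \<exists>u<n. a = u * Suc n then 0 else M2 a)"
          have M3: "M3 = (\<lambda>a. if \<exists>w<n. a = w * Suc n then 0 else if a < n * n then 1 - ?M a else ?M a)"
            using 2 3 RM by auto
          have c3: "const_regs n R3" using 3 by blast
          have a3: "adjacency n (\<lambda>u v. {u, v} \<in> complement_graph n E) M3"
            unfolding M3 by (rule adjacency_complement_graph[OF adjacency_input])
          \<comment> \<open>The flips stop below n * n and the diagonal writes are zeros, so the
            price and owner arrays are still empty as the auction requires.\<close>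
          have z3: "\<forall>a\<ge>n * n. M3 a = 0"
            unfolding M3 by (simp add: input_state_simps)
          show "runs independent_prog R3 M3 (independent_time n) ?Q"
            by (rule runs_mono[OF runs_independent[OF simple_complement_graph c3 a3 z3] order_refl])
              (auto simp: near_max_independent_def max_clique_def max_independent_set_def
                independent_set_complement_graph)
        qed
      qed
      then show "runs (SEQ (INSTR (ADD 9 4 3)) (SEQ flip_prog (SEQ diagonal_prog independent_prog))) R M
        (Suc ((n * n * 6 + 1) + ((n * 4 + 3) + independent_time n))) ?Q"
        using RM unfolding R1_def by (simp add: const_regs_def)
    qed (simp add: input_state_simps)
    show "poly_bounded (\<lambda>n. (n * 3 + 8) + Suc ((n * n * 6 + 1) + ((n * 4 + 3) + independent_time n)))"
      by (intro poly_bounded_intros poly_bounded_independent_time)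
  qed
  then show ?thesis using hamming_approximation_half by blast
qed

theorem theorem3p2:
  shows "(\<exists>A. polytime_computable A \<and>
              hamming_approximation (\<lambda>n. real n / 2) min_vertex_cover A) \<and>
         (\<exists>A. polytime_computable A \<and>
              hamming_approximation (\<lambda>n. real n / 2) max_independent_set A) \<and>
         (\<exists>A. polytime_computable A \<and>
              hamming_approximation (\<lambda>n. real n / 2) max_clique A)"
  using vertex_cover_algorithm independent_set_algorithm clique_algorithm by blast

end
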